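(* There are $\mathfrak{S}_n$-modules $\mathbb{C}[\mathrm{PF}_n]$ and $\mathbb{C}[\mathrm{UPF}_n]$ (namely, the permutation modules on parking functions and on unit interval parking functions of length $n$ given by the actions specified in the context) such that \[\sum_{n\geq 0}\mathrm{ch}\,\mathbb{C}[\mathrm{PF}_n]\,z^{n+1}=(zE(-z))^{\langle -1\rangle }\quad\text{and}\quad\sum_{n\geq 0}\mathrm{ch}\, \mathbb{C}[\mathrm{UPF}_n]\,z^n=\frac{1}{2-H(z)},\] where $\mathrm{ch}$ denotes the Frobenius characteristic map from $\mathfrak{S}_n$-modules to symmetric functions of degree $n$, and $E(z)=\sum_{n\geq 0}e_nz^n$ and $H(z)=\sum_{n\geq 0}h_nz^n$ are the generating functions for the elementary and the complete homogeneous symmetric functions, respectively.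
   Context: Parking functions: $n$ cars enter a one-way street with spots $1,\dots,n$ in order; car $i$ has preferred spot $\alpha_i\in[n]$. Car $i$ parks in spot $\alpha_i$ if free, otherwise in the next free spot after $\alpha_i$, if any. $\alpha=(\alpha_1,\dots,\alpha_n)\in[n]^n$ is a parking function if all cars park; $\mathrm{PF}_n$ is the set of these. $\mathrm{UPF}_n$ (unit interval parking functions) is the set of $\alpha\in \mathrm{PF}_n$ such that each car $i$ parks in spot $\alpha_i$ or $\alpha_i+1$. $\mathbb{C}[X]$ is the complex vector space with basis $X$; an action of a group on $X$ is extended linearly. The action on $\mathrm{PF}_n$ is $\sigma\cdot\alpha=(\alpha_{\sigma^{-1}(1)},\dots,\alpha_{\sigma^{-1}(n)})$. Block structure: for $\alpha\in \mathrm{UPF}_n$ let $\beta$ be its weakly increasing rearrangement and $\{i\in[n]:\beta_i=i\}=\{i_1<\cdots<i_k\}$; the blocks are $\pi_j=\beta_{i_j}\beta_{i_j+1}\cdots\beta_{i_{j+1}-1}$ for $j\in[k]$ (with $i_{k+1}=n+1$). Distinct blocks have no value in common, so each entry of $\alpha$ lies in a well-defined block. The action on $\mathrm{UPF}_n$ is determined by the simple transpositions: $(i,i+1)\cdot\alpha=\alpha$ if $\alpha_i,\alpha_{i+1}$ are in the same block, and $(i,i+1)\cdot\alpha$ is $\alpha$ with entries $\alpha_i,\alpha_{i+1}$ swapped if they are in different blocks. For an $\mathfrak{S}_n$-module $V$ with character $\chi$, $\mathrm{ch}(V)=\frac1{n!}\sum_{\sigma\in \mathfrak{S}_n}\chi(\sigma)p_{cyc(\sigma)}$,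 where $p_\lambda$ are the power-sum symmetric functions and $cyc(\sigma)$ is the cycle type. The $n=0$ terms have Frobenius image $1$. $P(z)^{\langle-1\rangle}$ is the compositional inverse of the power series $P(z)$, i.e. the series $Q$ with $Q(P(z))=z$. *)

theory Defs
  imports
    "HOL-Library.Multiset"
    "HOL-Library.FuncSet"
    "HOL-Library.Poly_Mapping"
    "HOL-Combinatorics.Permutations"
    "HOL-Combinatorics.Orbits"
    "HOL-Computational_Algebra.Formal_Power_Series"
    "HOL-Algebra.Group_Action"
    "HOL-Algebra.Sym_Groups"
begin

section \<open>The ring of symmetric functions\<close>

text \<open>
  A monomial in the variables \<open>x\<^sub>0, x\<^sub>1, \<dots>\<close> is encoded as the finite multiset of the indices of its
  variables, so the product of monomials is multiset union and the degree is the size. A symmetric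
  function is a formal power series of bounded degree whose coefficients are
  invariant under permutations of the variables.
\<close>

typedef symfun =
  "{f :: nat multiset \<Rightarrow> complex.
      (\<forall>\<pi> m. bij \<pi> \<longrightarrow> f (image_mset \<pi> m) = f m) \<and>
      (\<exists>d. \<forall>m. f m \<noteq> 0 \<longrightarrow> size m \<le> d)}"
  morphisms sf_coeff Abs_symfun
  by (rule exI[of _ "\<lambda>_. 0"]) auto

setup_lifting type_definition_symfun

definition splits :: "nat multiset \<Rightarrow> (nat multiset \<times> nat multiset) set" where
  "splits m = {(a, b). a + b = m}"

lemma finite_splits [simp]: "finite (splits m)"
proof (induction m)
  case empty
  have "splits {#} = {({#}, {#})}"
    by (auto simp: splits_def)
  then show ?case by simp
next
  case (add x m)
  have "splits (add_mset x m) \<subseteq>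
      (\<lambda>(a, b). (add_mset x a, b)) ` splits m \<union> (\<lambda>(a, b). (a, add_mset x b)) ` splits m"
  proof
    fix p assume p: "p \<in> splits (add_mset x m)"
    obtain a b where ab: "p = (a, b)" by (cases p)
    with p have eq: "a + b = add_mset x m" by (simp add: splits_def)
    then have "x \<in># a + b" by simp
    then consider "x \<in># a" | "x \<in># b" by auto
    then show "p \<in> (\<lambda>(a, b). (add_mset x a, b)) ` splits m \<union> (\<lambda>(a, b). (a, add_mset x b)) ` splits m"
    proof cases
      case 1
      then obtain a' where a': "a = add_mset x a'" by (meson mset_add)
      with eq have "(a', b) \<in> splits m" by (simp add: splits_def)
      then show ?thesis using ab a' by force
    next
      case 2
      then obtain b' where b': "b = add_mset x b'" by (meson mset_add)
      with eq have "(a, b') \<in> splits m" by (simp add: splits_def)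
      then show ?thesis using ab b' by force
    qed
  qed
  then show ?case
    by (rule finite_subset) (use add in simp)
qed

lemma sum_splits_image:
  assumes "bij \<pi>"
  shows "(\<Sum>(a, b)\<in>splits (image_mset \<pi> m). F a b) =
         (\<Sum>(a, b)\<in>splits m. F (image_mset \<pi> a) (image_mset \<pi> b))"
proof -
  have inv: "image_mset (inv_into UNIV \<pi>) (image_mset \<pi> a) = a"
            "image_mset \<pi> (image_mset (inv_into UNIV \<pi>) a) = a" for a
    using assms by (simp_all add: multiset.map_comp o_def bij_is_inj bij_is_surj surj_f_inv_f)
  show ?thesis
    by (rule sum.reindex_bij_witness[where
          i = "map_prod (image_mset \<pi>) (image_mset \<pi>)" and
          j = "map_prod (image_mset (inv_into UNIV \<pi>)) (image_mset (inv_into UNIV \<pi>))"])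
       (auto simp: splits_def inv simp flip: image_mset_union)
qed

instantiation symfun :: comm_ring_1
begin

lift_definition zero_symfun :: symfun is "\<lambda>_. 0" by auto

lift_definition one_symfun :: symfun is "\<lambda>m. if m = {#} then 1 else 0"
  by (auto intro: exI[of _ 0])

lift_definition plus_symfun :: "symfun \<Rightarrow> symfun \<Rightarrow> symfun" is "\<lambda>f g m. f m + g m"
proof (intro CollectI conjI, goal_cases)
  case (2 f g)
  then obtain d e where "\<forall>m. f m \<noteq> 0 \<longrightarrow> size m \<le> d" "\<forall>m. g m \<noteq> 0 \<longrightarrow> size m \<le> e" by auto
  then show ?case
    by (intro exI[of _ "max d e"]) (metis add.right_neutral max.coboundedI1 max.coboundedI2)
qed auto

lift_definition uminus_symfun :: "symfun \<Rightarrow> symfun" is "\<lambda>f m. - f m" by auto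

lift_definition minus_symfun :: "symfun \<Rightarrow> symfun \<Rightarrow> symfun" is "\<lambda>f g m. f m - g m"
proof (intro CollectI conjI, goal_cases)
  case (2 f g)
  then obtain d e where "\<forall>m. f m \<noteq> 0 \<longrightarrow> size m \<le> d" "\<forall>m. g m \<noteq> 0 \<longrightarrow> size m \<le> e" by auto
  then show ?case
    by (intro exI[of _ "max d e"]) (metis diff_zero max.coboundedI1 max.coboundedI2)
qed auto

lift_definition times_symfun :: "symfun \<Rightarrow> symfun \<Rightarrow> symfun" is
  "\<lambda>f g m. \<Sum>(a, b)\<in>splits m. f a * g b"
proof (intro CollectI conjI, goal_cases)
  case (1 f g)
  then show ?case by (auto simp: sum_splits_image)
next
  case (2 f g)
  then obtain d e where de: "\<forall>m. f m \<noteq> 0 \<longrightarrow> size m \<le> d" "\<forall>m. g m \<noteq> 0 \<longrightarrow> size m \<le> e" by auto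
  show ?case
  proof (intro exI[of _ "d + e"] allI impI)
    fix m assume "(\<Sum>(a, b)\<in>splits m. f a * g b) \<noteq> 0"
    then obtain p where "p \<in> splits m" "(case p of (a, b) \<Rightarrow> f a * g b) \<noteq> 0"
      by (meson sum.neutral)
    then obtain a b where "a + b = m" "f a \<noteq> 0" "g b \<noteq> 0"
      by (auto simp: splits_def)
    then show "size m \<le> d + e" using de by (metis add_mono size_union)
  qed
qed

instance
proof
  fix f g h :: symfun
  show "f * g * h = f * (g * h)"
  proof (transfer, rule ext)
    fix f g h :: "nat multiset \<Rightarrow> complex" and m
    have "(\<Sum>(a, b)\<in>splits m. (\<Sum>(c, d)\<in>splits a. f c * g d) * h b) =
          (\<Sum>(p, q)\<in>Sigma (splits m) (\<lambda>p. splits (fst p)). f (fst q) * g (snd q) * h (snd p))"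
      by (subst sum.Sigma[symmetric]) (auto simp: sum_distrib_right case_prod_unfold)
    also have "\<dots> = (\<Sum>(p, q)\<in>Sigma (splits m) (\<lambda>p. splits (snd p)). f (fst p) * (g (fst q) * h (snd q)))"
      by (rule sum.reindex_bij_witness[where
            i = "\<lambda>((a, b), (c, d)). ((a + c, d), (a, c))" and
            j = "\<lambda>((a, b), (c, d)). ((c, d + b), (d, b))"])
         (auto simp: splits_def add.assoc)
    also have "\<dots> = (\<Sum>(a, b)\<in>splits m. f a * (\<Sum>(c, d)\<in>splits b. g c * h d))"
      by (subst sum.Sigma[symmetric]) (auto simp: sum_distrib_left case_prod_unfold)
    finally show "(\<Sum>(a, b)\<in>splits m. (\<Sum>(c, d)\<in>splits a. f c * g d) * h b) =
        (\<Sum>(a, b)\<in>splits m. f a * (\<Sum>(c, d)\<in>splits b. g c * h d))" .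
  qed
  show "f * g = g * f"
  proof (transfer, rule ext)
    fix f g :: "nat multiset \<Rightarrow> complex" and m
    show "(\<Sum>(a, b)\<in>splits m. f a * g b) = (\<Sum>(a, b)\<in>splits m. g a * f b)"
      by (rule sum.reindex_bij_witness[where i = prod.swap and j = prod.swap])
         (auto simp: splits_def add.commute mult.commute)
  qed
  show "1 * f = f"
  proof (transfer, rule ext)
    fix f :: "nat multiset \<Rightarrow> complex" and m
    have "(\<Sum>(a, b)\<in>splits m. (if a = {#} then 1 else 0) * f b) =
          (\<Sum>(a, b)\<in>{({#} :: nat multiset, m)}. (if a = {#} then 1 else 0) * f b)"
      by (intro sum.mono_neutral_right finite_splits) (auto simp: splits_def split: if_splits)
    then show "(\<Sum>(a, b)\<in>splits m. (if a = {#} then 1 else 0) * f b) = f m" by simp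
  qed
  show "(f + g) * h = f * h + g * h"
    by (transfer, rule ext) (simp add: case_prod_unfold distrib_right sum.distrib)
  show "f + g + h = f + (g + h)" by transfer (simp add: add.assoc)
  show "f + g = g + f" by transfer (simp add: add.commute)
  show "0 + f = f" by transfer simp
  show "- f + f = 0" by transfer simp
  show "f - g = f + - g" by transfer simp
  show "(0 :: symfun) \<noteq> 1" by transfer (metis zero_neq_one)
qed

end

lift_definition sf_scale :: "complex \<Rightarrow> symfun \<Rightarrow> symfun" is "\<lambda>c f m. c * f m" by auto

lemma count_image_mset_bij:
  assumes "bij \<pi>"
  shows "count (image_mset \<pi> m) (\<pi> i) = count m i"
  using assms by (induction m) (auto simp: bij_is_inj inj_eq)

lift_definition sf_e :: "nat \<Rightarrow> symfun" is
  "\<lambda>n m. if size m = n \<and> (\<forall>i. count m i \<le> 1) then 1 else 0"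
proof (intro CollectI conjI allI impI, goal_cases)
  case (1 n \<pi> m)
  then have "(\<forall>i. count (image_mset \<pi> m) i \<le> 1) \<longleftrightarrow> (\<forall>i. count m i \<le> 1)"
    by (metis bij_pointE count_image_mset_bij)
  then show ?case by simp
qed auto

lift_definition sf_h :: "nat \<Rightarrow> symfun" is "\<lambda>n m. if size m = n then 1 else 0"
  by auto

lift_definition sf_p :: "nat \<Rightarrow> symfun" is
  "\<lambda>k m. if \<exists>i. m = replicate_mset k i then 1 else 0"
proof (intro CollectI conjI allI impI, goal_cases)
  case (1 k \<pi> m)
  have "(\<exists>i. image_mset \<pi> m = replicate_mset k i) \<longleftrightarrow> (\<exists>i. m = replicate_mset k i)"
  proof
    assume "\<exists>i. image_mset \<pi> m = replicate_mset k i"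
    then obtain i where i: "image_mset \<pi> m = replicate_mset k i" ..
    have "m = image_mset (inv_into UNIV \<pi>) (image_mset \<pi> m)"
      using 1 by (simp add: multiset.map_comp o_def bij_is_inj)
    then show "\<exists>i. m = replicate_mset k i" using i by auto
  qed auto
  then show ?case by simp
next
  case (2 k)
  show ?case by (intro exI[of _ k]) auto
qed

definition sf_p_part :: "nat multiset \<Rightarrow> symfun" where
  "sf_p_part \<mu> = (\<Prod>k\<in>#\<mu>. sf_p k)"

definition E_series :: "symfun fps" where "E_series = Abs_fps sf_e"

definition H_series :: "symfun fps" where "H_series = Abs_fps sf_h"


section \<open>Permutation modules and the Frobenius characteristic\<close>

text \<open>
  The vector space \<open>\<complex>[X]\<close> consists of the \<open>v :: 'a \<Rightarrow>\<^sub>0 complex\<close> with \<open>Poly_Mapping.keys v \<subseteq> X\<close>; the basis vector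
  of \<open>x \<in> X\<close> is \<open>Poly_Mapping.single x 1\<close>.
\<close>

definition lin_ext :: "('a \<Rightarrow> 'a) \<Rightarrow> ('a \<Rightarrow>\<^sub>0 complex) \<Rightarrow> ('a \<Rightarrow>\<^sub>0 complex)" where
  "lin_ext f v = (\<Sum>x\<in>Poly_Mapping.keys v. Poly_Mapping.single (f x) (Poly_Mapping.lookup v x))"

definition trace_on :: "'a set \<Rightarrow> (('a \<Rightarrow>\<^sub>0 complex) \<Rightarrow> ('a \<Rightarrow>\<^sub>0 complex)) \<Rightarrow> complex" where
  "trace_on X T = (\<Sum>x\<in>X. Poly_Mapping.lookup (T (Poly_Mapping.single x 1)) x)"

definition perm_character ::
    "'a set \<Rightarrow> ((nat \<Rightarrow> nat) \<Rightarrow> 'a \<Rightarrow> 'a) \<Rightarrow> (nat \<Rightarrow> nat) \<Rightarrow> complex" where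
  "perm_character X \<phi> \<sigma> = trace_on X (lin_ext (\<phi> \<sigma>))"

text \<open>Fixed points count as cycles of length 1.\<close>

definition cycle_type :: "nat \<Rightarrow> (nat \<Rightarrow> nat) \<Rightarrow> nat multiset" where
  "cycle_type n \<sigma> = image_mset card (mset_set ((\<lambda>i. Orbits.orbit \<sigma> i) ` {1..n}))"

definition frobenius_ch :: "nat \<Rightarrow> ((nat \<Rightarrow> nat) \<Rightarrow> complex) \<Rightarrow> symfun" where
  "frobenius_ch n \<chi> = sf_scale (1 / fact n)
     (\<Sum>\<sigma>\<in>carrier (sym_group n). sf_scale (\<chi> \<sigma>) (sf_p_part (cycle_type n \<sigma>)))"

definition ch_perm_module ::
    "nat \<Rightarrow> 'a set \<Rightarrow> ((nat \<Rightarrow> nat) \<Rightarrow> 'a \<Rightarrow> 'a) \<Rightarrow> symfun" where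
  "ch_perm_module n X \<phi> = frobenius_ch n (perm_character X \<phi>)"


section \<open>Parking functions\<close>

text \<open>
  Preference vectors in \<open>[n]\<^sup>n\<close> are the functions in \<open>{1..n} \<rightarrow>\<^sub>E {1..n}\<close>. The function
  \<open>next_free n S a\<close> gives the first spot from \<open>a\<close> on that is not in the set \<open>S\<close> of occupied spots,
  and \<open>occupied n \<alpha> k\<close> is the set of spots taken by cars \<open>1, \<dots>, k\<close>.
\<close>

definition next_free :: "nat \<Rightarrow> nat set \<Rightarrow> nat \<Rightarrow> nat option" where
  "next_free n S a =
     (if \<exists>s\<in>{a..n}. s \<notin> S then Some (LEAST s. s \<in> {a..n} \<and> s \<notin> S) else None)"

primrec occupied :: "nat \<Rightarrow> (nat \<Rightarrow> nat) \<Rightarrow> nat \<Rightarrow> nat set" where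
  "occupied n \<alpha> 0 = {}"
| "occupied n \<alpha> (Suc k) =
     occupied n \<alpha> k \<union> set_option (next_free n (occupied n \<alpha> k) (\<alpha> (Suc k)))"

definition car_spot :: "nat \<Rightarrow> (nat \<Rightarrow> nat) \<Rightarrow> nat \<Rightarrow> nat option" where
  "car_spot n \<alpha> i = next_free n (occupied n \<alpha> (i - 1)) (\<alpha> i)"

definition PF :: "nat \<Rightarrow> (nat \<Rightarrow> nat) set" where
  "PF n = {\<alpha> \<in> {1..n} \<rightarrow>\<^sub>E {1..n}. \<forall>i\<in>{1..n}. car_spot n \<alpha> i \<noteq> None}"

definition UPF :: "nat \<Rightarrow> (nat \<Rightarrow> nat) set" where
  "UPF n = {\<alpha> \<in> PF n. \<forall>i\<in>{1..n}. car_spot n \<alpha> i \<in> {Some (\<alpha> i), Some (\<alpha> i + 1)}}"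

text \<open>
  Group actions in \<open>HOL-Algebra\<close> map group elements to extensional functions, hence the restriction to
  \<open>PF n\<close>. Since \<open>\<sigma>\<close> fixes everything outside \<open>{1..n}\<close>, the composition
  stays extensional on \<open>{1..n}\<close>.
\<close>

definition PF_action :: "nat \<Rightarrow> (nat \<Rightarrow> nat) \<Rightarrow> (nat \<Rightarrow> nat) \<Rightarrow> (nat \<Rightarrow> nat)" where
  "PF_action n \<sigma> = (\<lambda>\<alpha>\<in>PF n. \<alpha> \<circ> inv_into UNIV \<sigma>)"


section \<open>Block structure of unit interval parking functions\<close>

definition rearrangement :: "nat \<Rightarrow> (nat \<Rightarrow> nat) \<Rightarrow> nat \<Rightarrow> nat" where
  "rearrangement n \<alpha> i = sort (map \<alpha> [1..<n + 1]) ! (i - 1)"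

definition block_starts :: "nat \<Rightarrow> (nat \<Rightarrow> nat) \<Rightarrow> nat list" where
  "block_starts n \<alpha> = sorted_list_of_set {i \<in> {1..n}. rearrangement n \<alpha> i = i}"

definition blocks :: "nat \<Rightarrow> (nat \<Rightarrow> nat) \<Rightarrow> nat list list" where
  "blocks n \<alpha> =
     (let bs = block_starts n \<alpha> @ [n + 1]
      in map (\<lambda>j. map (rearrangement n \<alpha>) [bs ! j ..< bs ! (j + 1)]) [0..<length (block_starts n \<alpha>)])"

definition same_block :: "nat \<Rightarrow> (nat \<Rightarrow> nat) \<Rightarrow> nat \<Rightarrow> nat \<Rightarrow> bool" where
  "same_block n \<alpha> a b \<longleftrightarrow> (\<exists>\<pi>\<in>set (blocks n \<alpha>). a \<in> set \<pi> \<and> b \<in> set \<pi>)"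

text \<open>
  The simple transpositions generate the symmetric group, so on \<open>UPF n\<close> at most one group action
  satisfies this predicate.
\<close>

definition is_UPF_action ::
    "nat \<Rightarrow> ((nat \<Rightarrow> nat) \<Rightarrow> (nat \<Rightarrow> nat) \<Rightarrow> (nat \<Rightarrow> nat)) \<Rightarrow> bool" where
  "is_UPF_action n \<phi> \<longleftrightarrow>
     group_action (sym_group n) (UPF n) \<phi> \<and>
     (\<forall>i\<in>{1..<n}. \<forall>\<alpha>\<in>UPF n.
        \<phi> (Transposition.transpose i (i + 1)) \<alpha> =
          (if same_block n \<alpha> (\<alpha> i) (\<alpha> (i + 1)) then \<alpha>
           else \<alpha> \<circ> Transposition.transpose i (i + 1)))"

end

theory Submission
  imports Defs
begin

text \<open>
  Both modules are permutation modules on words \<open>{1..n} \<rightarrow> nat\<close> whose letters are moved around by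
  \<open>\<SS>\<^sub>n\<close>, and the set of words in question is a union of full rearrangement classes. For such a module
  the Frobenius image is the sum, over the contents \<open>c\<close> of the words, of the products
  \<open>h\<^bsub>c\<^sub>1\<^esub> h\<^bsub>c\<^sub>2\<^esub> \<dots>\<close> of complete homogeneous functions (\<open>ch_words_module\<close>). The
  proof compares coefficients of a monomial \<open>m\<close>: the coefficient of \<open>p\<^bsub>cyc(\<sigma>)\<^esub>\<close> is the number of words of
  content \<open>m\<close> fixed by \<open>\<sigma>\<close> (\<open>sf_coeff_p_cycle_type\<close>), so \<open>n!\<close> times the coefficient of \<open>ch\<close> counts
  pairs of a permutation and a word of letter pairs fixed by it. Burnside's lemma
  (\<open>sum_card_fixed_words\<close>) turns this into the number of possible contents of such words of pairs, that
  is, of multisets of pairs with prescribed margins, and the product of the \<open>h\<^bsub>c\<^sub>j\<^esub>\<close> counts the same objects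
  (\<open>sf_coeff_h_prod\<close>).

  Parking functions. A preference vector parks all cars iff for every \<open>j\<close> at least \<open>j\<close> cars prefer a
  spot \<open>\<le> j\<close> (\<open>PF_iff_counts\<close>), a condition on the content alone. Let \<open>P(z) = \<Sum> ch \<complex>[PF\<^sub>n] z\<^sup>n\<close>. Cutting an
  arbitrary sequence of \<open>N + 1\<close> multiplicities with sum \<open>N\<close> at the first spot that stays empty
  (\<open>parking_decomposition\<close>) expresses \<open>[z\<^sup>N] H(z)\<^bsup>N+1\<^esup>\<close> as \<open>\<Sum>\<^sub>n ch \<complex>[PF\<^sub>n] [z\<^bsup>N-n\<^esup>] H(z)\<^bsup>N-n\<^esup>\<close>. As
  \<open>E(-z) H(z) = 1\<close>, this says that \<open>T(z) = \<Sum>\<^sub>n ch \<complex>[PF\<^sub>n] z\<^sup>n E(-z)\<^bsup>n+1\<^esup>\<close> satisfies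
  \<open>[z\<^sup>N] T H\<^bsup>N+1\<^esup> = [z\<^sup>N] H\<^bsup>N+1\<^esup>\<close> for all \<open>N\<close>, and this forces \<open>T = 1\<close>. But \<open>z T(z)\<close> is the composition of
  \<open>z P(z)\<close> with \<open>z E(-z)\<close>.

  Unit interval parking functions. They correspond to packed words, that is, words \<open>w\<close> with set of
  letters \<open>{1..k}\<close> for some \<open>k\<close>: the letter \<open>w i\<close> is the number of the block that contains the entry of
  car \<open>i\<close>. Within a block the cars park from left to right in the order of arrival, the first one in the spot
  it prefers and each later one in the spot after the one it prefers. So the spot of car \<open>i\<close> is given by the standardization
  of \<open>w\<close>, and \<open>w\<close> determines the parking function (\<open>word_encoding_UPF\<close>). Under this correspondence
  the prescribed action of adjacent transpositions is the permutation of the positions of \<open>w\<close>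
  (\<open>is_UPF_action_relabel\<close>). The contents of packed words are the compositions of \<open>n\<close> into positive
  parts, so the generating function is the geometric series of \<open>H(z) - 1\<close>.
\<close>

unbundle fps_syntax

section \<open>Coefficients of products\<close>

lemma sf_coeff_one: "sf_coeff 1 m = (if m = {#} then 1 else 0)"
  by transfer simp

lemma sf_coeff_mult: "sf_coeff (f * g) m = (\<Sum>(a, b)\<in>splits m. sf_coeff f a * sf_coeff g b)"
  by transfer simp

lemma sf_coeff_add: "sf_coeff (f + g) m = sf_coeff f m + sf_coeff g m"
  by transfer simp

lemma sf_coeff_zero: "sf_coeff 0 m = 0"
  by transfer simp

lemma sf_coeff_scale: "sf_coeff (sf_scale c f) m = c * sf_coeff f m"
  by transfer simp

lemma sf_coeff_sum: "sf_coeff (\<Sum>x\<in>A. f x) m = (\<Sum>x\<in>A. sf_coeff (f x) m)"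
  by (induction A rule: infinite_finite_induct) (auto simp: sf_coeff_zero sf_coeff_add)

lemma symfun_eqI: "(\<And>m. sf_coeff f m = sf_coeff g m) \<Longrightarrow> f = g"
  by (metis ext sf_coeff_inject)

text \<open>
  Monomials are multisets of variables, so if the \<open>j\<close>-th factor of a product is the sum of the monomials
  satisfying \<open>P j\<close>, these are the ways in which \<open>m\<close> arises when the product is expanded.
\<close>
definition factorizations ::
    "'i set \<Rightarrow> ('i \<Rightarrow> 'a multiset \<Rightarrow> bool) \<Rightarrow> 'a multiset \<Rightarrow> ('i \<Rightarrow> 'a multiset) set" where
  "factorizations J P m = {g \<in> J \<rightarrow>\<^sub>E UNIV. (\<forall>j\<in>J. P j (g j)) \<and> (\<Sum>j\<in>J. g j) = m}"

lemma finite_submultisets: "finite {a :: nat multiset. a \<subseteq># m}"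
proof (rule finite_subset)
  show "{a. a \<subseteq># m} \<subseteq> fst ` splits m"
    by (force simp: splits_def mset_subset_eq_exists_conv image_iff)
qed simp

lemma finite_factorizations:
  fixes m :: "nat multiset"
  assumes "finite J"
  shows "finite (factorizations J P m)"
proof (rule finite_subset)
  show "factorizations J P m \<subseteq> J \<rightarrow>\<^sub>E {a. a \<subseteq># m}"
  proof
    fix g assume g: "g \<in> factorizations J P m"
    have "g j \<subseteq># m" if "j \<in> J" for j
    proof -
      have "(\<Sum>j\<in>J. g j) = g j + (\<Sum>j\<in>J - {j}. g j)"
        using assms that by (simp add: sum.remove)
      then show ?thesis using g unfolding factorizations_def by (metis (mono_tags, lifting) mem_Collect_eq mset_subset_eq_add_left)
    qed
    then show "g \<in> J \<rightarrow>\<^sub>E {a. a \<subseteq># m}" using g unfolding factorizations_def by auto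
  qed
  show "finite (J \<rightarrow>\<^sub>E {a. a \<subseteq># m})"
    using assms finite_submultisets by (intro finite_PiE)
qed

lemma card_factorizations_insert:
  fixes m :: "nat multiset"
  assumes "finite J" "i \<notin> J"
  shows "card (factorizations (insert i J) P m) =
    (\<Sum>(a, b)\<in>splits m. if P i a then card (factorizations J P b) else 0)"
proof -
  let ?S = "SIGMA p:{p \<in> splits m. P i (fst p)}. factorizations J P (snd p)"
  have upd: "(\<Sum>j\<in>J. if j = i then a else g j) = sum g J" for g :: "_ \<Rightarrow> nat multiset" and a
    using assms by (intro sum.cong) auto
  have "bij_betw (\<lambda>(p, g). g(i := fst p)) ?S (factorizations (insert i J) P m)"
  proof (rule bij_betwI[where g = "\<lambda>g. ((g i, \<Sum>j\<in>J. g j), restrict g J)"])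
    show "(\<lambda>(p, g). g(i := fst p)) \<in> ?S \<rightarrow> factorizations (insert i J) P m"
      using assms by (auto simp: factorizations_def splits_def upd PiE_def extensional_def split: if_splits)
    show "(\<lambda>g. ((g i, \<Sum>j\<in>J. g j), restrict g J)) \<in> factorizations (insert i J) P m \<rightarrow> ?S"
      using assms by (auto simp: factorizations_def splits_def)
    show "(\<lambda>g. ((g i, \<Sum>j\<in>J. g j), restrict g J)) ((\<lambda>(p, g). g(i := fst p)) x) = x"
      if "x \<in> ?S" for x
      using that assms
      by (auto simp: factorizations_def upd restrict_def PiE_def extensional_def fun_eq_iff)
    show "(\<lambda>(p, g). g(i := fst p)) ((\<lambda>g. ((g i, \<Sum>j\<in>J. g j), restrict g J)) g) = g"
      if "g \<in> factorizations (insert i J) P m" for g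
      using that by (auto simp: factorizations_def restrict_def PiE_def extensional_def fun_eq_iff)
  qed
  then have "card (factorizations (insert i J) P m) = card ?S"
    by (simp add: bij_betw_same_card)
  also have "\<dots> = (\<Sum>p\<in>{p \<in> splits m. P i (fst p)}. card (factorizations J P (snd p)))"
    using finite_factorizations[OF assms(1)] by (intro card_SigmaI) auto
  also have "\<dots> = (\<Sum>(a, b)\<in>splits m. if P i a then card (factorizations J P b) else 0)"
    by (simp add: sum.If_cases case_prod_unfold Collect_conj_eq)
  finally show ?thesis .
qed

lemma sf_coeff_prod_indicator:
  assumes "finite J"
    and "\<And>j a. j \<in> J \<Longrightarrow> sf_coeff (F j) a = (if P j a then 1 else 0)"
  shows "sf_coeff (\<Prod>j\<in>J. F j) m = of_nat (card (factorizations J P m))"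
  using assms
proof (induction J arbitrary: m rule: finite_induct)
  case empty
  have "factorizations {} P m = (if m = {#} then {\<lambda>_. undefined} else {})"
    by (auto simp: factorizations_def)
  then show ?case by (simp add: sf_coeff_one)
next
  case (insert i J)
  then show ?case
    by (auto simp: sf_coeff_mult card_factorizations_insert case_prod_unfold intro!: sum.cong)
qed

section \<open>Words and their contents\<close>

definition content :: "nat \<Rightarrow> (nat \<Rightarrow> 'a) \<Rightarrow> 'a multiset" where
  "content n f = image_mset f (mset_set {1..n})"

lemma size_content [simp]: "size (content n f) = n"
  by (simp add: content_def)

lemma set_content [simp]: "set_mset (content n f) = f ` {1..n}"
  by (simp add: content_def)

lemma image_content: "image_mset h (content n f) = content n (h \<circ> f)"
  by (simp add: content_def multiset.map_comp)

lemma content_cong: "(\<And>i. i \<in> {1..n} \<Longrightarrow> f i = g i) \<Longrightarrow> content n f = content n g"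
  unfolding content_def by (intro image_mset_cong) auto

lemma content_permute:
  assumes "\<sigma> permutes {1..n}"
  shows "content n (f \<circ> \<sigma>) = content n f"
proof -
  have "image_mset \<sigma> (mset_set {1..n}) = mset_set {1..n}"
    using assms by (simp add: permutes_inj_on permutes_image image_mset_mset_set)
  then show ?thesis
    unfolding content_def by (metis multiset.map_comp)
qed

lemma content_eq_permute:
  assumes "f \<in> {1..n} \<rightarrow>\<^sub>E UNIV" "g \<in> {1..n} \<rightarrow>\<^sub>E UNIV" "content n f = content n g"
  obtains \<sigma> where "\<sigma> permutes {1..n}" "g \<circ> \<sigma> = f"
proof -
  obtain \<sigma> where \<sigma>: "\<sigma> permutes {1..n}" "\<forall>x\<in>{1..n}. f x = g (\<sigma> x)"
    using image_mset_eq_implies_permutes[of "{1..n}" f g] assms(3)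
    unfolding content_def by auto
  have "g (\<sigma> x) = f x" for x
    using \<sigma> assms(1,2) by (cases "x \<in> {1..n}") (auto simp: permutes_not_in PiE_def extensional_def)
  then show ?thesis using that \<sigma>(1) by (simp add: fun_eq_iff)
qed

lemma ex_word_with_content:
  assumes "size M = n"
  obtains f where "f \<in> {1..n} \<rightarrow>\<^sub>E UNIV" "content n f = M"
proof -
  obtain xs where xs: "mset xs = M" using ex_mset by blast
  have "content n (\<lambda>i. xs ! (i - 1)) = M"
  proof -
    have "mset_set {1..n} = image_mset Suc (mset_set {0..<n})"
      by (simp add: image_mset_mset_set image_Suc_atLeastLessThan atLeastLessThanSuc_atLeastAtMost)
    then have "content n (\<lambda>i. xs ! (i - 1)) = image_mset (\<lambda>i. xs ! i) (mset_set {0..<n})"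
      by (simp add: content_def multiset.map_comp comp_def)
    also have "\<dots> = mset (map (\<lambda>i. xs ! i) [0..<length xs])"
      using assms xs by (auto simp flip: mset_upt)
    finally show ?thesis by (simp add: map_nth xs)
  qed
  then have "content n (restrict (\<lambda>i. xs ! (i - 1)) {1..n}) = M"
    by (subst content_cong[of n _ "\<lambda>i. xs ! (i - 1)"]) auto
  then show ?thesis using that[of "restrict (\<lambda>i. xs ! (i - 1)) {1..n}"] by auto
qed

lemma word_compose_permutation:
  assumes "f \<in> {1..n} \<rightarrow>\<^sub>E A" "\<sigma> permutes {1..n}"
  shows "f \<circ> \<sigma> \<in> {1..n} \<rightarrow>\<^sub>E A"
proof (intro PiE_I)
  fix i assume "i \<in> {1..n}"
  then have "\<sigma> i \<in> {1..n}" by (simp only: permutes_in_image[OF assms(2)])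
  then show "(f \<circ> \<sigma>) i \<in> A" using assms(1) by auto
next
  fix i assume "i \<notin> {1..n}"
  then show "(f \<circ> \<sigma>) i = undefined"
    using permutes_not_in[OF assms(2)] PiE_arb[OF assms(1)] by simp
qed

lemma word_fixed_inv_iff:
  assumes "\<sigma> permutes S"
  shows "f \<circ> inv_into UNIV \<sigma> = f \<longleftrightarrow> f \<circ> \<sigma> = f"
proof
  assume "f \<circ> inv_into UNIV \<sigma> = f"
  then have "f \<circ> \<sigma> = f \<circ> inv_into UNIV \<sigma> \<circ> \<sigma>" by simp
  then show "f \<circ> \<sigma> = f" by (simp add: comp_assoc permutes_inv_o[OF assms])
next
  assume "f \<circ> \<sigma> = f"
  then have "f \<circ> inv_into UNIV \<sigma> = f \<circ> \<sigma> \<circ> inv_into UNIV \<sigma>" by simp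
  then show "f \<circ> inv_into UNIV \<sigma> = f" by (simp add: comp_assoc permutes_inv_o[OF assms])
qed

text \<open>
  Burnside's lemma for words. Two words have the same content iff they differ by a permutation of the
  positions, so the contents enumerate the orbits; a class contributes \<open>n!\<close> because the permutations
  fixing a word \<open>g\<close> are in bijection with those carrying a reference word \<open>h\<close> of the class to \<open>g\<close>.
\<close>
lemma sum_card_fixed_words:
  assumes fin: "finite G" and G: "G \<subseteq> {1..n} \<rightarrow>\<^sub>E UNIV"
    and closed: "\<And>g \<sigma>. g \<in> G \<Longrightarrow> \<sigma> permutes {1..n} \<Longrightarrow> g \<circ> \<sigma> \<in> G"
  shows "(\<Sum>\<sigma> | \<sigma> permutes {1..n}. card {g \<in> G. g \<circ> \<sigma> = g}) = fact n * card (content n ` G)"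
proof -
  define S where "S = {\<sigma>. \<sigma> permutes {1..n}}"
  have finS: "finite S" unfolding S_def by (simp add: finite_permutations)
  have class_count: "(\<Sum>g | g \<in> G \<and> content n g = c. card {\<sigma> \<in> S. g \<circ> \<sigma> = g}) = fact n"
    if c: "c \<in> content n ` G" for c
  proof -
    obtain h where h: "h \<in> G" "content n h = c" using c by auto
      \<comment> \<open>The stabilizer of \<open>g\<close> and the set of permutations carrying \<open>h\<close> to \<open>g\<close> differ by a translation.\<close>
  have coset: "card {\<sigma> \<in> S. g \<circ> \<sigma> = g} = card {\<sigma> \<in> S. h \<circ> \<sigma> = g}"
      if "g \<in> G" "content n g = c" for g
    proof -
      obtain \<tau> where \<tau>: "\<tau> permutes {1..n}" "h \<circ> \<tau> = g"
      proof (rule content_eq_permute[of g n h])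
        show "g \<in> {1..n} \<rightarrow>\<^sub>E UNIV" "h \<in> {1..n} \<rightarrow>\<^sub>E UNIV" using \<open>g \<in> G\<close> h G by auto
        show "content n g = content n h" using \<open>content n g = c\<close> h by simp
      qed
      have inv: "inv_into UNIV \<tau> \<circ> \<tau> = id" "\<tau> \<circ> inv_into UNIV \<tau> = id"
        using permutes_inv_o[OF \<tau>(1)] by auto
      have cancel: "inv_into UNIV \<tau> \<circ> (\<tau> \<circ> \<sigma>) = \<sigma>" "\<tau> \<circ> (inv_into UNIV \<tau> \<circ> \<sigma>) = \<sigma>" for \<sigma> :: "nat \<Rightarrow> nat"
        by (simp_all add: inv flip: comp_assoc)
      have "bij_betw (\<lambda>\<sigma>. \<tau> \<circ> \<sigma>) {\<sigma> \<in> S. g \<circ> \<sigma> = g} {\<sigma> \<in> S. h \<circ> \<sigma> = g}"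
      proof (rule bij_betwI[where g = "\<lambda>\<sigma>. inv_into UNIV \<tau> \<circ> \<sigma>"])
        show "(\<lambda>\<sigma>. \<tau> \<circ> \<sigma>) \<in> {\<sigma> \<in> S. g \<circ> \<sigma> = g} \<rightarrow> {\<sigma> \<in> S. h \<circ> \<sigma> = g}"
          using \<tau> by (auto simp: S_def permutes_compose simp flip: comp_assoc)
        show "(\<lambda>\<sigma>. inv_into UNIV \<tau> \<circ> \<sigma>) \<in> {\<sigma> \<in> S. h \<circ> \<sigma> = g} \<rightarrow> {\<sigma> \<in> S. g \<circ> \<sigma> = g}"
        proof
          fix \<sigma> assume "\<sigma> \<in> {\<sigma> \<in> S. h \<circ> \<sigma> = g}"
          then show "inv_into UNIV \<tau> \<circ> \<sigma> \<in> {\<sigma> \<in> S. g \<circ> \<sigma> = g}"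
            using \<tau>(1) by (simp add: S_def permutes_compose permutes_inv comp_assoc cancel flip: \<tau>(2))
        qed
      qed (simp_all add: cancel)
      then show ?thesis by (rule bij_betw_same_card)
    qed
    have "(\<Sum>g | g \<in> G \<and> content n g = c. card {\<sigma> \<in> S. g \<circ> \<sigma> = g}) =
        (\<Sum>g | g \<in> G \<and> content n g = c. card {\<sigma> \<in> S. h \<circ> \<sigma> = g})"
      using coset by (intro sum.cong) auto
    also have "\<dots> = (\<Sum>g | g \<in> G \<and> content n g = c. \<Sum>\<sigma> | \<sigma> \<in> S \<and> h \<circ> \<sigma> = g. 1)"
      by simp
    also have "\<dots> = (\<Sum>\<sigma>\<in>S. 1)"
      using finS fin h closed by (intro sum.group) (auto simp: S_def content_permute)
    also have "\<dots> = fact n" by (simp add: S_def card_permutations)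
    finally show ?thesis .
  qed
  have "(\<Sum>\<sigma>\<in>S. card {g \<in> G. g \<circ> \<sigma> = g}) = (\<Sum>\<sigma>\<in>S. \<Sum>g | g \<in> G \<and> g \<circ> \<sigma> = g. 1)"
    by simp
  also have "\<dots> = (\<Sum>g\<in>G. \<Sum>\<sigma> | \<sigma> \<in> S \<and> g \<circ> \<sigma> = g. 1)"
    using finS fin by (rule sum.swap_restrict)
  also have "\<dots> = (\<Sum>g\<in>G. card {\<sigma> \<in> S. g \<circ> \<sigma> = g})" by simp
  also have "\<dots> = (\<Sum>c\<in>content n ` G. \<Sum>g | g \<in> G \<and> content n g = c. card {\<sigma> \<in> S. g \<circ> \<sigma> = g})"
    using fin by (rule sum.image_gen)
  also have "\<dots> = (\<Sum>c\<in>content n ` G. fact n)"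
    using class_count by (intro sum.cong) auto
  finally show ?thesis by (simp add: S_def)
qed

section \<open>Power sums as counts of fixed words\<close>

lemma sf_p_part_cycle_type:
  "sf_p_part (cycle_type n \<sigma>) = (\<Prod>C\<in>(\<lambda>i. Orbits.orbit \<sigma> i) ` {1..n}. sf_p (card C))"
  by (simp add: sf_p_part_def cycle_type_def prod_unfold_prod_mset multiset.map_comp comp_def)

lemma sf_coeff_p: "sf_coeff (sf_p k) m = (if \<exists>i. m = replicate_mset k i then 1 else 0)"
  by transfer simp

lemma sf_coeff_h: "sf_coeff (sf_h k) m = (if size m = k then 1 else 0)"
  by transfer simp

lemma image_mset_sum: "image_mset f (\<Sum>j\<in>J. F j) = (\<Sum>j\<in>J. image_mset f (F j))"
  by (induction J rule: infinite_finite_induct) auto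

lemma filter_mset_sum: "filter_mset p (\<Sum>j\<in>J. F j) = (\<Sum>j\<in>J. filter_mset p (F j))"
  by (induction J rule: infinite_finite_induct) auto

lemma invariant_on_orbit:
  assumes "f \<circ> \<sigma> = f" "j \<in> Orbits.orbit \<sigma> i"
  shows "f j = f i"
  using assms(2) by induction (use assms(1) in \<open>auto simp: fun_eq_iff\<close>)

text \<open>
  A choice of one variable for every cycle of \<open>\<sigma>\<close> is a word that is constant on the cycles, and the
  monomial \<open>\<Prod>\<^sub>C x\<^bsub>f(C)\<^esub>\<^bsup>|C|\<^esup>\<close> it contributes to the product of power sums is the content of that word.
\<close>
lemma sf_coeff_p_cycle_type:
  assumes \<sigma>: "\<sigma> permutes {1..n}"
  shows "sf_coeff (sf_p_part (cycle_type n \<sigma>)) m =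
    of_nat (card {f \<in> {1..n} \<rightarrow>\<^sub>E UNIV. f \<circ> \<sigma> = f \<and> content n f = m})"
proof -
  let ?O = "Orbits.orbit \<sigma>" and ?Os = "(\<lambda>i. Orbits.orbit \<sigma> i) ` {1..n}"
  let ?P = "\<lambda>C a. \<exists>i. a = replicate_mset (card C) i"
  let ?W = "{f \<in> {1..n} \<rightarrow>\<^sub>E UNIV. f \<circ> \<sigma> = f \<and> content n f = m}"
  let ?F = "\<lambda>f. \<lambda>C\<in>?Os. image_mset f (mset_set C)"
  have perm: "permutation \<sigma>" using \<sigma> by (auto simp: permutation_permutes)
  have self: "i \<in> ?O i" for i using perm by (rule permutation_self_in_orbit)
  have orbit_eq: "?O j = ?O i" if "j \<in> ?O i" for i j
    using orbit_cyclic_eq3[OF cyclic_on_orbit'[OF perm] that] .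
  have sub: "?O i \<subseteq> {1..n}" if "i \<in> {1..n}" for i
    using permutes_orbit_subset[OF \<sigma> that] .
  have finO: "finite C" if "C \<in> ?Os" for C
  proof -
    obtain i where "i \<in> {1..n}" "C = ?O i" using \<open>C \<in> ?Os\<close> by auto
    then show "finite C" using sub[of i] by (simp add: finite_subset)
  qed
  have union: "\<Union> ?Os = {1..n}" using sub self by blast
  have disj: "\<forall>A\<in>?Os. \<forall>B\<in>?Os. A \<noteq> B \<longrightarrow> A \<inter> B = {}"
    using orbit_eq by blast
  have sum_orbits: "(\<Sum>C\<in>?Os. image_mset f (mset_set C)) = content n f" for f :: "nat \<Rightarrow> nat"
  proof -
    have single: "image_mset f (mset_set A) = (\<Sum>x\<in>A. {#f x#})" if "finite A" for A
      using that by (induction A rule: finite_induct) auto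
    have "(\<Sum>C\<in>?Os. image_mset f (mset_set C)) = (\<Sum>C\<in>?Os. \<Sum>x\<in>C. {#f x#})"
      using single finO by (intro sum.cong) auto
    also have "\<dots> = (\<Sum>x\<in>\<Union> ?Os. {#f x#})"
      using finO disj by (subst sum.Union_disjoint) auto
    finally show ?thesis unfolding union content_def by (simp add: single)
  qed
  have const: "image_mset f (mset_set C) = replicate_mset (card C) x"
    if "\<And>j. j \<in> C \<Longrightarrow> f j = x" "finite C" for f :: "nat \<Rightarrow> nat" and C x
  proof -
    have "image_mset f (mset_set C) = image_mset (\<lambda>_. x) (mset_set C)"
      using that by (intro image_mset_cong) auto
    then show ?thesis by (simp add: image_mset_const_eq)
  qed
  have "bij_betw ?F ?W (factorizations ?Os ?P m)"
  proof (rule bij_betw_imageI)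
    show "inj_on ?F ?W"
    proof (rule inj_onI)
      fix f f' assume f: "f \<in> ?W" and f': "f' \<in> ?W" and eq: "?F f = ?F f'"
      have "f i = f' i" if i: "i \<in> {1..n}" for i
      proof -
        have "image_mset f (mset_set (?O i)) = image_mset f' (mset_set (?O i))"
          using fun_cong[OF eq, of "?O i"] i by auto
        then have "f ` ?O i = f' ` ?O i"
          using finO[of "?O i"] i by (metis finite_set_mset_mset_set image_eqI set_image_mset)
        then obtain j where "j \<in> ?O i" "f i = f' j" using self[of i] by blast
        then show ?thesis using invariant_on_orbit[of f' \<sigma> j i] f' by auto
      qed
      then show "f = f'" using f f' by (intro PiE_ext[of f "{1..n}" "\<lambda>_. UNIV" f']) auto
    qed
    show "?F ` ?W = factorizations ?Os ?P m"
    proof (intro equalityI subsetI)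
      fix g assume "g \<in> ?F ` ?W"
      then obtain f where f: "f \<in> ?W" and g: "g = ?F f" by blast
      have "?P C (g C)" if "C \<in> ?Os" for C
      proof -
        obtain i where i: "i \<in> {1..n}" "C = ?O i" using \<open>C \<in> ?Os\<close> by auto
        have "image_mset f (mset_set C) = replicate_mset (card C) (f i)"
          using f i finO[OF that] by (intro const) (auto intro: invariant_on_orbit)
        then show ?thesis using that g by auto
      qed
      moreover have "(\<Sum>C\<in>?Os. g C) = m"
        using f sum_orbits[of f] by (simp add: g)
      ultimately show "g \<in> factorizations ?Os ?P m" by (auto simp: factorizations_def g)
    next
      fix g assume g: "g \<in> factorizations ?Os ?P m"
      then have "\<forall>C\<in>?Os. \<exists>i. g C = replicate_mset (card C) i" by (simp add: factorizations_def)
      then obtain x where x: "\<And>C. C \<in> ?Os \<Longrightarrow> g C = replicate_mset (card C) (x C)" by metis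
      define f where "f = (\<lambda>i\<in>{1..n}. x (?O i))"
      have inv: "f \<circ> \<sigma> = f"
      proof
        fix i
        show "(f \<circ> \<sigma>) i = f i"
          using permutes_in_image[OF \<sigma>, of i] orbit_eq[of "\<sigma> i" i]
          by (simp add: f_def Orbits.orbit.base restrict_def)
      qed
      have Fg: "image_mset f (mset_set C) = g C" if C: "C \<in> ?Os" for C
        unfolding x[OF C]
      proof (rule const)
        fix j assume j: "j \<in> C"
        obtain i where i: "i \<in> {1..n}" "C = ?O i" using C by auto
        have "j \<in> {1..n}" using j sub[OF i(1)] unfolding i(2) by (rule set_mp[rotated])
        moreover have "?O j = C" using orbit_eq[of j i] j i(2) by simp
        ultimately show "f j = x C" by (simp add: f_def)
      qed (rule finO[OF C])
      have "content n f = m"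
        using g Fg by (simp add: factorizations_def flip: sum_orbits)
      then have "f \<in> ?W" using inv by (simp add: f_def)
      moreover have "?F f = g"
        using g Fg by (intro PiE_ext[of "?F f" ?Os "\<lambda>_. UNIV" g]) (auto simp: factorizations_def)
      ultimately show "g \<in> ?F ` ?W" by blast
    qed
  qed
  then have "card ?W = card (factorizations ?Os ?P m)" by (rule bij_betw_same_card)
  then show ?thesis
    unfolding sf_p_part_cycle_type by (subst sf_coeff_prod_indicator[of _ _ ?P]) (auto simp: sf_coeff_p)
qed

section \<open>Products of complete homogeneous functions\<close>

definition h_prod :: "'a multiset \<Rightarrow> symfun" where
  "h_prod c = (\<Prod>j\<in>set_mset c. sf_h (count c j))"

text \<open>
  Such a multiset of pairs is a matrix of multiplicities with row sums given by \<open>c\<close> and column sums given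
  by \<open>m\<close>.
\<close>
definition pairings :: "'a multiset \<Rightarrow> 'b multiset \<Rightarrow> ('a \<times> 'b) multiset set" where
  "pairings c m = {M. image_mset fst M = c \<and> image_mset snd M = m}"

lemma size_fibre: "size (filter_mset (\<lambda>x. fst x = j) M) = count (image_mset fst M) j"
  by (induction M) auto

lemma sum_fibres:
  assumes "finite J" "fst ` set_mset M \<subseteq> J"
  shows "(\<Sum>j\<in>J. filter_mset (\<lambda>x. fst x = j) M) = M"
proof (rule multiset_eqI)
  fix x
  show "count (\<Sum>j\<in>J. filter_mset (\<lambda>x. fst x = j) M) x = count M x"
    using assms by (cases "x \<in># M") (auto simp: count_sum not_in_iff image_subset_iff)
qed

text \<open>
  Row \<open>j\<close> of the matrix is the monomial chosen from the \<open>j\<close>-th factor \<open>h\<^bsub>c\<^sub>j\<^esub>\<close>.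
\<close>
lemma bij_betw_pairings_factorizations:
  fixes c :: "'a multiset" and m :: "nat multiset"
  defines "J \<equiv> set_mset c"
  shows "bij_betw (\<lambda>M. \<lambda>j\<in>J. image_mset snd (filter_mset (\<lambda>x. fst x = j) M))
    (pairings c m) (factorizations J (\<lambda>j a. size a = count c j) m)"
proof (rule bij_betwI[where g = "\<lambda>g. \<Sum>j\<in>J. image_mset (Pair j) (g j)"])
  let ?fibres = "\<lambda>M. \<lambda>j\<in>J. image_mset snd (filter_mset (\<lambda>x. fst x = j) M)"
  let ?glue = "\<lambda>g. \<Sum>j\<in>J. image_mset (Pair j) (g j)"
  have finJ: "finite J" by (simp add: J_def)
  have sumJ: "(\<Sum>j\<in>J. filter_mset (\<lambda>x. fst x = j) M) = M" if "image_mset fst M = c"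
    for M :: "('a \<times> nat) multiset"
    using that by (intro sum_fibres) (simp_all add: J_def flip: set_image_mset)
  show "?fibres \<in> pairings c m \<rightarrow> factorizations J (\<lambda>j a. size a = count c j) m"
  proof
    fix M assume M: "M \<in> pairings c m"
    have "(\<Sum>j\<in>J. ?fibres M j) = image_mset snd (\<Sum>j\<in>J. filter_mset (\<lambda>x. fst x = j) M)"
      by (simp add: image_mset_sum)
    then show "?fibres M \<in> factorizations J (\<lambda>j a. size a = count c j) m"
      using M sumJ by (auto simp: factorizations_def pairings_def size_fibre)
  qed
  show "?glue \<in> factorizations J (\<lambda>j a. size a = count c j) m \<rightarrow> pairings c m"
  proof
    fix g assume g: "g \<in> factorizations J (\<lambda>j a. size a = count c j) m"
    have "image_mset fst (?glue g) = (\<Sum>j\<in>J. replicate_mset (size (g j)) j)"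
      by (simp add: image_mset_sum multiset.map_comp comp_def image_mset_const_eq)
    also have "\<dots> = (\<Sum>j\<in>J. replicate_mset (count c j) j)"
      using g by (intro sum.cong) (auto simp: factorizations_def)
    also have "\<dots> = c"
      by (rule multiset_eqI) (auto simp: count_sum J_def count_eq_zero_iff)
    finally have "image_mset fst (?glue g) = c" .
    moreover have "image_mset snd (?glue g) = m"
      using g by (simp add: image_mset_sum multiset.map_comp comp_def factorizations_def)
    ultimately show "?glue g \<in> pairings c m" by (simp add: pairings_def)
  qed
  show "?glue (?fibres M) = M" if M: "M \<in> pairings c m" for M
  proof -
    have "image_mset (Pair j) (image_mset snd (filter_mset (\<lambda>x. fst x = j) M)) =
        filter_mset (\<lambda>x. fst x = j) M" for j
      by (induction M) auto
    then show ?thesis using M sumJ by (simp add: pairings_def)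
  qed
  show "?fibres (?glue g) = g" if g: "g \<in> factorizations J (\<lambda>j a. size a = count c j) m" for g
  proof (rule PiE_ext[of _ J "\<lambda>_. UNIV"])
    fix i assume i: "i \<in> J"
    have "filter_mset (\<lambda>x. fst x = i) (image_mset (Pair j) (g j)) =
        (if j = i then image_mset (Pair i) (g i) else {#})" for j
      by (auto simp: filter_mset_eq_conv)
    then show "?fibres (?glue g) i = g i"
      using i finJ by (simp add: filter_mset_sum multiset.map_comp comp_def)
  qed (use g in \<open>auto simp: factorizations_def\<close>)
qed

lemma sf_coeff_h_prod: "sf_coeff (h_prod c) m = of_nat (card (pairings c m))"
  unfolding h_prod_def bij_betw_same_card[OF bij_betw_pairings_factorizations]
  by (rule sf_coeff_prod_indicator) (auto simp: sf_coeff_h)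

lemma finite_pairings: "finite (pairings c (m :: nat multiset))"
  using bij_betw_finite[OF bij_betw_pairings_factorizations[of c m]] finite_factorizations by auto

section \<open>The Frobenius characteristic of a module of words\<close>

definition words :: "nat \<Rightarrow> 'a multiset set \<Rightarrow> (nat \<Rightarrow> 'a) set" where
  "words n C = {w \<in> {1..n} \<rightarrow>\<^sub>E UNIV. content n w \<in> C}"

lemma finite_words:
  assumes "finite C"
  shows "finite (words n C)"
proof (rule finite_subset)
  show "words n C \<subseteq> {1..n} \<rightarrow>\<^sub>E (\<Union>c\<in>C. set_mset c)"
  proof
    fix w assume w: "w \<in> words n C"
    then have "w ` {1..n} = set_mset (content n w)" "content n w \<in> C" by (auto simp: words_def)
    then have "w ` {1..n} \<subseteq> (\<Union>c\<in>C. set_mset c)" by blast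
    then show "w \<in> {1..n} \<rightarrow>\<^sub>E (\<Union>c\<in>C. set_mset c)" using w by (auto simp: words_def)
  qed
  show "finite ({1..n} \<rightarrow>\<^sub>E (\<Union>c\<in>C. set_mset c))"
    using assms by (intro finite_PiE) auto
qed

lemma words_closed:
  assumes "w \<in> words n C" "\<sigma> permutes {1..n}"
  shows "w \<circ> \<sigma> \<in> words n C"
  using assms word_compose_permutation[of w n UNIV \<sigma>] by (simp add: words_def content_permute)

lemma content_words:
  assumes "\<And>c. c \<in> C \<Longrightarrow> size c = n"
  shows "content n ` words n C = C"
proof
  show "C \<subseteq> content n ` words n C"
  proof
    fix c assume "c \<in> C"
    moreover obtain w where "w \<in> {1..n} \<rightarrow>\<^sub>E UNIV" "content n w = c"
      using ex_word_with_content assms[OF \<open>c \<in> C\<close>] by blast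
    ultimately show "c \<in> content n ` words n C" by (auto simp: words_def)
  qed
qed (auto simp: words_def)

lemma perm_character_eq_card:
  assumes "finite X"
  shows "perm_character X \<phi> \<sigma> = of_nat (card {x \<in> X. \<phi> \<sigma> x = x})"
proof -
  have "perm_character X \<phi> \<sigma> = (\<Sum>x\<in>X. if \<phi> \<sigma> x = x then 1 else 0)"
    unfolding perm_character_def trace_on_def lin_ext_def
    by (intro sum.cong) (auto simp: lookup_single when_def)
  also have "\<dots> = of_nat (card {x \<in> X. \<phi> \<sigma> x = x})"
    using assms by (simp flip: sum.inter_filter)
  finally show ?thesis .
qed

lemma content_restrict_compose:
  "content n (restrict (h \<circ> g) {1..n}) = image_mset h (content n g)"
  unfolding image_content by (rule content_cong) auto

lemma restrict_compose_fixed: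
  assumes "\<sigma> permutes S" "g \<circ> \<sigma> = g"
  shows "restrict (h \<circ> g) S \<circ> \<sigma> = restrict (h \<circ> g) S"
proof
  fix i
  show "(restrict (h \<circ> g) S \<circ> \<sigma>) i = restrict (h \<circ> g) S i"
    using fun_cong[OF assms(2), of i] permutes_in_image[OF assms(1), of i]
    by (simp add: restrict_def)
qed

text \<open>
  A pair of words fixed by \<open>\<sigma>\<close> is the same as a fixed word of pairs of letters. This converts the product of the
  character with the coefficient of \<open>p\<^bsub>cyc(\<sigma>)\<^esub>\<close> into a single count to which Burnside's lemma applies.
\<close>
lemma card_fixed_word_pairs:
  assumes "\<sigma> permutes {1..n}"
  shows "card {w \<in> words n C. w \<circ> \<sigma> = w} * card {f \<in> {1..n} \<rightarrow>\<^sub>E UNIV. f \<circ> \<sigma> = f \<and> content n f = m} =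
    card {g \<in> words n (\<Union>c\<in>C. pairings c m). g \<circ> \<sigma> = g}" (is "card ?A * card ?B = card ?G")
proof -
  let ?pair = "\<lambda>(w, f). \<lambda>i\<in>{1..n}. (w i, f i)"
  have in_range: "\<sigma> i \<in> {1..n} \<longleftrightarrow> i \<in> {1..n}" for i using assms by (rule permutes_in_image)
  have "bij_betw ?pair (?A \<times> ?B) ?G"
  proof (rule bij_betwI[where g = "\<lambda>g. (restrict (fst \<circ> g) {1..n}, restrict (snd \<circ> g) {1..n})"])
    show "?pair \<in> ?A \<times> ?B \<rightarrow> ?G"
    proof (clarsimp)
      fix w f assume w: "w \<in> words n C" "w \<circ> \<sigma> = w"
        and f: "f \<in> {Suc 0..n} \<rightarrow>\<^sub>E UNIV" "f \<circ> \<sigma> = f" "m = content n f"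
      let ?g = "\<lambda>i\<in>{1..n}. (w i, f i)"
      have "image_mset fst (content n ?g) = content n w" "image_mset snd (content n ?g) = content n f"
        unfolding image_content by (auto intro!: content_cong)
      then have "content n ?g \<in> (\<Union>c\<in>C. pairings c (content n f))"
        using w by (auto simp: words_def pairings_def)
      moreover have "?g \<circ> \<sigma> = ?g"
      proof
        fix i
        show "(?g \<circ> \<sigma>) i = ?g i"
          using fun_cong[OF w(2), of i] fun_cong[OF f(2), of i] in_range[of i]
          by (simp add: restrict_def)
      qed
      ultimately show "(\<lambda>i\<in>{Suc 0..n}. (w i, f i)) \<in> words n (\<Union>c\<in>C. pairings c (content n f)) \<and>
          (\<lambda>i\<in>{Suc 0..n}. (w i, f i)) \<circ> \<sigma> = (\<lambda>i\<in>{Suc 0..n}. (w i, f i))"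
        by (simp add: words_def)
    qed
    show "(\<lambda>g. (restrict (fst \<circ> g) {1..n}, restrict (snd \<circ> g) {1..n})) \<in> ?G \<rightarrow> ?A \<times> ?B"
    proof
      fix g assume "g \<in> ?G"
      then show "(restrict (fst \<circ> g) {1..n}, restrict (snd \<circ> g) {1..n}) \<in> ?A \<times> ?B"
        using content_restrict_compose[of n fst g] content_restrict_compose[of n snd g]
          restrict_compose_fixed[OF assms, of g fst] restrict_compose_fixed[OF assms, of g snd]
        by (auto simp: words_def pairings_def)
    qed
  next
    show "(restrict (fst \<circ> ?pair x) {1..n}, restrict (snd \<circ> ?pair x) {1..n}) = x"
      if "x \<in> ?A \<times> ?B" for x
      using that by (auto simp: words_def fun_eq_iff restrict_def PiE_def extensional_def)
    show "?pair (restrict (fst \<circ> g) {1..n}, restrict (snd \<circ> g) {1..n}) = g" if "g \<in> ?G" for g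
      using that by (auto simp: words_def fun_eq_iff restrict_def PiE_def extensional_def)
  qed
  then show ?thesis by (simp add: bij_betw_same_card card_cartesian_product flip: card_cartesian_product)
qed

text \<open>
  By Burnside's lemma the coefficient of \<open>m\<close> counts the contents of words of pairs whose first components
  form a word with content in \<open>C\<close> and whose second components have content \<open>m\<close>; sorted by the first
  margin \<open>c\<close> these are the pairings counted by \<open>h_prod c\<close>. Assuming the character of the word
  module, rather than the module itself, covers every relabelling of the basis.
\<close>
theorem ch_words_module:
  assumes C: "finite C" "\<And>c. c \<in> C \<Longrightarrow> size c = n"
    and X: "finite X"
    and fixed: "\<And>\<sigma>. \<sigma> permutes {1..n} \<Longrightarrow>
      card {x \<in> X. \<phi> \<sigma> x = x} = card {w \<in> words n C. w \<circ> \<sigma> = w}"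
  shows "ch_perm_module n X \<phi> = (\<Sum>c\<in>C. h_prod c)"
proof (rule symfun_eqI)
  fix m :: "nat multiset"
  let ?D = "\<Union>c\<in>C. pairings c m"
  have finD: "finite ?D" using C(1) finite_pairings by auto
  have sizeD: "size M = n" if "M \<in> ?D" for M
  proof -
    obtain c where "c \<in> C" "image_mset fst M = c" using \<open>M \<in> ?D\<close> by (auto simp: pairings_def)
    then show ?thesis using C(2) by (metis size_image_mset)
  qed
  have "sf_coeff (ch_perm_module n X \<phi>) m =
      1 / fact n * (\<Sum>\<sigma> | \<sigma> permutes {1..n}. perm_character X \<phi> \<sigma> * sf_coeff (sf_p_part (cycle_type n \<sigma>)) m)"
    by (simp add: ch_perm_module_def frobenius_ch_def sf_coeff_scale sf_coeff_sum sym_group_def)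
  also have "(\<Sum>\<sigma> | \<sigma> permutes {1..n}. perm_character X \<phi> \<sigma> * sf_coeff (sf_p_part (cycle_type n \<sigma>)) m) =
      of_nat (\<Sum>\<sigma> | \<sigma> permutes {1..n}. card {g \<in> words n ?D. g \<circ> \<sigma> = g})"
    unfolding of_nat_sum
    by (intro sum.cong)
       (auto simp: perm_character_eq_card[OF X] sf_coeff_p_cycle_type fixed
             simp del: of_nat_mult simp flip: of_nat_mult card_fixed_word_pairs)
  also have "(\<Sum>\<sigma> | \<sigma> permutes {1..n}. card {g \<in> words n ?D. g \<circ> \<sigma> = g}) = fact n * card ?D"
    using sum_card_fixed_words[OF finite_words[OF finD], of n n] words_closed[of _ n ?D] content_words[of ?D n] sizeD
    by (auto simp: words_def)
  also have "card ?D = (\<Sum>c\<in>C. card (pairings c m))"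
    using C(1) finite_pairings by (intro card_UN_disjoint) (auto simp: pairings_def)
  finally show "sf_coeff (ch_perm_module n X \<phi>) m = sf_coeff (\<Sum>c\<in>C. h_prod c) m"
    by (simp add: sf_coeff_sum sf_coeff_h_prod)
qed

section \<open>Sequences of block sizes\<close>

definition h_list :: "nat list \<Rightarrow> symfun" where
  "h_list ds = prod_list (map sf_h ds)"

text \<open>
  The content of a word in which the letter \<open>j\<close> occurs \<open>ds ! (j - 1)\<close> times: spots, and hence letters, are
  counted from 1, but list positions from 0.
\<close>
definition block_content :: "nat list \<Rightarrow> nat multiset" where
  "block_content ds = (\<Sum>i<length ds. replicate_mset (ds ! i) (Suc i))"

lemma block_content_Nil [simp]: "block_content [] = {#}"
  by (simp add: block_content_def)

lemma block_content_snoc [simp]: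
  "block_content (ds @ [d]) = block_content ds + replicate_mset d (Suc (length ds))"
  by (simp add: block_content_def nth_append)

lemma size_block_content [simp]: "size (block_content ds) = sum_list ds"
  by (induction ds rule: rev_induct) auto

lemma count_block_content:
  "count (block_content ds) j = (if j \<in> {1..length ds} then ds ! (j - 1) else 0)"
  by (induction ds rule: rev_induct) (auto simp: nth_append le_Suc_eq Suc_le_eq)

lemma set_block_content: "set_mset (block_content ds) \<subseteq> {1..length ds}"
  by (auto simp: count_block_content count_greater_zero_iff[symmetric] simp del: count_greater_zero_iff split: if_splits)

lemma block_content_inject:
  assumes "length ds = length es" "block_content ds = block_content es"
  shows "ds = es"
proof (rule nth_equalityI)
  fix i assume "i < length ds"
  then show "ds ! i = es ! i"
    using assms count_block_content[of ds "Suc i"] count_block_content[of es "Suc i"] by simp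
qed (fact assms(1))

lemma block_content_counts:
  assumes "set_mset c \<subseteq> {1..k}"
  shows "block_content (map (count c) [1..<k + 1]) = c"
proof (rule multiset_eqI)
  fix j
  show "count (block_content (map (count c) [1..<k + 1])) j = count c j"
    using assms by (auto simp: count_block_content not_in_iff subset_iff simp del: upt_Suc)
qed

lemma size_filter_block_content:
  "size (filter_mset (\<lambda>x. x \<le> j) (block_content ds)) = sum_list (take j ds)"
proof (induction ds rule: rev_induct)
  case (snoc d ds)
  have "filter_mset (\<lambda>x. x \<le> j) (replicate_mset d (Suc (length ds))) =
      (if length ds < j then replicate_mset d (Suc (length ds)) else {#})"
    by (auto simp: filter_mset_eq_conv)
  then show ?case using snoc by simp
qed simp

lemma sf_h_0: "sf_h 0 = 1"
  by (rule symfun_eqI) (simp add: sf_coeff_h sf_coeff_one)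

lemma h_prod_block_content: "h_prod (block_content ds) = h_list ds"
proof -
  have "h_prod (block_content ds) = (\<Prod>j\<in>{1..length ds}. sf_h (count (block_content ds) j))"
    unfolding h_prod_def using set_block_content[of ds]
    by (intro prod.mono_neutral_left) (auto simp: not_in_iff sf_h_0)
  also have "\<dots> = (\<Prod>i\<in>{0..<length ds}. sf_h (ds ! i))"
    by (rule prod.reindex_bij_witness[where i = Suc and j = "\<lambda>j. j - 1"])
       (auto simp: count_block_content)
  also have "\<dots> = h_list ds" by (simp add: h_list_def prod.list_conv_set_nth)
  finally show ?thesis .
qed

definition weak_compositions :: "nat \<Rightarrow> nat \<Rightarrow> nat list set" where
  "weak_compositions k n = {ds. length ds = k \<and> sum_list ds = n}"

definition compositions :: "nat \<Rightarrow> nat list set" where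
  "compositions n = {ds. 0 \<notin> set ds \<and> sum_list ds = n}"

text \<open>
  Read as the lengths of the vertical runs of a lattice path, these are the Dyck paths of semilength \<open>n\<close>.
\<close>
definition parking_compositions :: "nat \<Rightarrow> nat list set" where
  "parking_compositions n = {ds \<in> weak_compositions n n. \<forall>j\<le>n. j \<le> sum_list (take j ds)}"

lemma finite_weak_compositions [simp]: "finite (weak_compositions k n)"
proof (rule finite_subset)
  show "weak_compositions k n \<subseteq> {ds. set ds \<subseteq> {..n} \<and> length ds = k}"
    using member_le_sum_list by (auto simp: weak_compositions_def)
qed (simp add: finite_lists_length_eq)

lemma length_le_sum_list: "0 \<notin> set ds \<Longrightarrow> length ds \<le> sum_list ds" for ds :: "nat list"
  by (induction ds) auto

lemma finite_compositions [simp]: "finite (compositions n)"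
proof (rule finite_subset)
  show "compositions n \<subseteq> (\<Union>k\<le>n. weak_compositions k n)"
    using length_le_sum_list by (auto simp: compositions_def weak_compositions_def)
qed simp

lemma finite_parking_compositions [simp]: "finite (parking_compositions n)"
  by (simp add: parking_compositions_def)

section \<open>Generating functions of compositions and parking compositions\<close>

lemma weak_compositions_Suc:
  "weak_compositions (Suc k) n = (\<lambda>(d, ds). d # ds) ` (SIGMA d:{0..n}. weak_compositions k (n - d))"
  by (force simp: weak_compositions_def length_Suc_conv image_iff)

lemma H_series_nth [simp]: "H_series $ n = sf_h n"
  by (simp add: H_series_def)

lemma H_power_nth: "(H_series ^ k) $ n = (\<Sum>ds\<in>weak_compositions k n. h_list ds)"
proof (induction k arbitrary: n)
  case 0
  have "weak_compositions 0 n = (if n = 0 then {[]} else {})"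
    by (auto simp: weak_compositions_def)
  then show ?case by (simp add: h_list_def)
next
  case (Suc k)
  have "(\<Sum>ds\<in>weak_compositions (Suc k) n. h_list ds) =
      (\<Sum>(d, ds)\<in>(SIGMA d:{0..n}. weak_compositions k (n - d)). sf_h d * h_list ds)"
    unfolding weak_compositions_Suc
    by (subst sum.reindex) (auto simp: inj_on_def h_list_def case_prod_unfold)
  also have "\<dots> = (\<Sum>d\<in>{0..n}. sf_h d * (\<Sum>ds\<in>weak_compositions k (n - d). h_list ds))"
    by (subst sum.Sigma[symmetric]) (auto simp: sum_distrib_left)
  also have "\<dots> = (H_series ^ Suc k) $ n"
    by (simp add: fps_mult_nth Suc H_series_nth)
  finally show ?case ..
qed

definition composition_series :: "symfun fps" where
  "composition_series = Abs_fps (\<lambda>n. \<Sum>ds\<in>compositions n. h_list ds)"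

definition parking_series :: "symfun fps" where
  "parking_series = Abs_fps (\<lambda>n. \<Sum>ds\<in>parking_compositions n. h_list ds)"

lemma compositions_0: "compositions 0 = {[]}"
proof -
  have "0 \<notin> set ds \<Longrightarrow> sum_list ds = 0 \<Longrightarrow> ds = []" for ds :: "nat list"
    by (cases ds) auto
  then show ?thesis by (auto simp: compositions_def)
qed

lemma compositions_pos:
  assumes "n > 0"
  shows "compositions n = (\<lambda>(d, ds). d # ds) ` (SIGMA d:{1..n}. compositions (n - d))"
proof (intro equalityI subsetI)
  fix ds assume ds: "ds \<in> compositions n"
  then obtain d es where "ds = d # es" using assms by (cases ds) (auto simp: compositions_def)
  then show "ds \<in> (\<lambda>(d, ds). d # ds) ` (SIGMA d:{1..n}. compositions (n - d))"
    using ds by (force simp: compositions_def)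
qed (auto simp: compositions_def)

lemma composition_series_eq: "composition_series * (2 - H_series) = 1"
proof -
  have "composition_series = 1 + (H_series - 1) * composition_series"
  proof (rule fps_ext)
    fix n
    show "composition_series $ n = (1 + (H_series - 1) * composition_series) $ n"
    proof (cases "n = 0")
      case True
      then show ?thesis
        by (simp add: composition_series_def compositions_0 h_list_def sf_h_0)
    next
      case False
      have "composition_series $ n =
          (\<Sum>(d, ds)\<in>(SIGMA d:{1..n}. compositions (n - d)). sf_h d * h_list ds)"
        using False unfolding composition_series_def
        by (simp add: compositions_pos, subst sum.reindex)
           (auto simp: inj_on_def h_list_def case_prod_unfold)
      also have "\<dots> = (\<Sum>d\<in>{1..n}. sf_h d * composition_series $ (n - d))"
        by (subst sum.Sigma[symmetric]) (auto simp: sum_distrib_left composition_series_def)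
      also have "\<dots> = (\<Sum>d\<in>{0..n}. (H_series - 1) $ d * composition_series $ (n - d))"
        by (rule sum.mono_neutral_cong_left) (auto simp: sf_h_0 Suc_le_eq)
      finally show ?thesis using False by (simp add: fps_mult_nth)
    qed
  qed
  then show ?thesis by (simp add: algebra_simps)
qed

text \<open>
  If \<open>cs\<close> counts the cars preferring each of the spots \<open>1, \<dots>, N + 1\<close> and there are \<open>N\<close> cars, then the first
  spot \<open>n + 1\<close> left empty is the first one such that at most \<open>n\<close> cars prefer a spot \<open>\<le> n + 1\<close>. Exactly \<open>n\<close>
  cars then prefer a spot \<open>\<le> n\<close>, and they form a parking function; nobody prefers spot \<open>n + 1\<close>, and the
  preferences for the remaining \<open>N - n\<close> spots are unrestricted.
\<close>
lemma parking_decomposition: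
  "bij_betw (\<lambda>(n, ds, es). ds @ 0 # es)
    (SIGMA n:{0..N}. parking_compositions n \<times> weak_compositions (N - n) (N - n))
    (weak_compositions (Suc N) N)"
  (is "bij_betw ?join ?S _")
proof (rule bij_betw_imageI)
  show "inj_on ?join ?S"
  proof (rule inj_onI)
    fix p p' assume p: "p \<in> ?S" "p' \<in> ?S" "?join p = ?join p'"
    obtain n ds es n' ds' es' where pp: "p = (n, ds, es)" "p' = (n', ds', es')"
      by (metis prod.collapse)
    have ds: "ds \<in> parking_compositions n" and ds': "ds' \<in> parking_compositions n'"
      and eq: "ds @ 0 # es = ds' @ 0 # es'"
      using p by (auto simp: pp)
    \<comment> \<open>The cutting point is determined: after \<open>n + 1\<close> entries the left list is short, the right one is not.\<close>
    have sep: False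
      if "n < n'" "ds \<in> parking_compositions n" "ds' \<in> parking_compositions n'" "ds @ 0 # es = ds' @ 0 # es'"
      for n n' ds ds' es es'
    proof -
      have "sum_list (take (Suc n) (ds @ 0 # es)) = n"
        using that(2) by (simp add: parking_compositions_def weak_compositions_def)
      moreover have "Suc n \<le> sum_list (take (Suc n) (ds' @ 0 # es'))"
        using that(1,3) by (auto simp: parking_compositions_def weak_compositions_def)
      ultimately show False using that(4) by simp
    qed
    have n: "n = n'" using sep[OF _ ds ds' eq] sep[OF _ ds' ds eq[symmetric]] by (meson nat_neq_iff)
    then have "length ds = length ds'"
      using ds ds' by (simp add: parking_compositions_def weak_compositions_def)
    then show "p = p'" using n eq by (simp add: pp)
  qed
  show "?join ` ?S = weak_compositions (Suc N) N"
  proof (intro equalityI subsetI)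
    fix cs assume "cs \<in> weak_compositions (Suc N) N"
    then have len: "length cs = Suc N" and sum: "sum_list cs = N"
      by (auto simp: weak_compositions_def)
    let ?P = "\<lambda>n. sum_list (take (Suc n) cs) \<le> n"
    define n where "n = (LEAST n. ?P n)"
    have PN: "?P N" using len sum by simp
    have Pn: "?P n" unfolding n_def using PN by (rule LeastI)
    have nN: "n \<le> N" unfolding n_def using PN by (rule Least_le)
    have before: "j \<le> sum_list (take j cs)" if "j \<le> n" for j
    proof (cases j)
      case (Suc i)
      then have "\<not> ?P i" using that not_less_Least[of i ?P] by (simp add: n_def)
      then show ?thesis using Suc by simp
    qed simp
    have split: "sum_list (take (Suc n) cs) = sum_list (take n cs) + cs ! n"
      using len nN by (simp add: take_Suc_conv_app_nth)
    have zero: "cs ! n = 0" and sumn: "sum_list (take n cs) = n"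
      using Pn split before[of n] by auto
    have cs: "cs = take n cs @ 0 # drop (Suc n) cs"
      using len nN zero by (metis id_take_nth_drop le_imp_less_Suc)
    have "sum_list (drop (Suc n) cs) = N - n"
      using sum sumn arg_cong[OF cs, of sum_list] by simp
    then have "(n, take n cs, drop (Suc n) cs) \<in> ?S"
      using nN len sumn before by (auto simp: parking_compositions_def weak_compositions_def min_def)
    then show "cs \<in> ?join ` ?S" using cs by (force simp: image_iff)
  qed (auto simp: parking_compositions_def weak_compositions_def)
qed

lemma H_power_parking:
  "(\<Sum>n\<in>{0..N}. parking_series $ n * (H_series ^ (N - n)) $ (N - n)) = (H_series ^ Suc N) $ N"
proof -
  have "(H_series ^ Suc N) $ N = (\<Sum>(n, ds, es)\<in>(SIGMA n:{0..N}. parking_compositions n \<times> weak_compositions (N - n) (N - n)).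
      h_list ds * h_list es)"
    unfolding H_power_nth sum.reindex_bij_betw[OF parking_decomposition, symmetric]
    by (intro sum.cong) (auto simp: h_list_def sf_h_0)
  also have "\<dots> = (\<Sum>n\<in>{0..N}. \<Sum>(ds, es)\<in>parking_compositions n \<times> weak_compositions (N - n) (N - n).
      h_list ds * h_list es)"
    by (subst sum.Sigma) (auto simp: case_prod_unfold)
  also have "\<dots> = (\<Sum>n\<in>{0..N}. parking_series $ n * (H_series ^ (N - n)) $ (N - n))"
    by (simp add: parking_series_def H_power_nth sum_product sum.cartesian_product)
  finally show ?thesis ..
qed

lemma sf_coeff_e: "sf_coeff (sf_e k) m = (if size m = k \<and> (\<forall>i. count m i \<le> 1) then 1 else 0)"
  by transfer simp

lemma sum_alternating_Pow:
  assumes "finite A"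
  shows "(\<Sum>S\<in>Pow A. (- 1) ^ card S) = (if A = {} then 1 else (0 :: complex))"
  using prod_diff_conv_sum[OF assms, of "\<lambda>_. 1" "\<lambda>_. 1 :: complex"] assms
  by (cases "A = {}") (auto simp: power_0_left card_eq_0_iff)

text \<open>
  The squarefree divisors of a monomial correspond to the sets of variables dividing it, and the signs
  cancel unless there are no variables.
\<close>
lemma sum_squarefree_splits:
  "(\<Sum>(a, b)\<in>splits m. if \<forall>i. count a i \<le> 1 then (- 1) ^ size a else 0) =
    (if m = {#} then 1 else (0 :: complex))"
proof -
  have "(\<Sum>(a, b)\<in>splits m. if \<forall>i. count a i \<le> 1 then (- 1) ^ size a else (0 :: complex)) =
      (\<Sum>(a, b)\<in>{(a, b) \<in> splits m. \<forall>i. count a i \<le> 1}. (- 1) ^ size a)"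
    by (simp add: sum.inter_filter case_prod_unfold Collect_case_prod)
  also have "\<dots> = (\<Sum>S\<in>Pow (set_mset m). (- 1) ^ card S)"
  proof (rule sum.reindex_bij_witness[where j = "\<lambda>(a, b). set_mset a" and
        i = "\<lambda>S. (mset_set S, m - mset_set S)"])
    fix p assume "p \<in> {(a, b) \<in> splits m. \<forall>i. count a i \<le> 1}"
    then obtain a b where p: "p = (a, b)" "a + b = m" "\<And>i. count a i \<le> 1"
      by (auto simp: splits_def)
    have a: "mset_set (set_mset a) = a"
    proof (rule multiset_eqI)
      fix i show "count (mset_set (set_mset a)) i = count a i"
        using p(3)[of i] by (cases "i \<in># a") (auto simp: not_in_iff count_greater_zero_iff[symmetric] simp del: count_greater_zero_iff)
    qed
    show "(mset_set (case p of (a, b) \<Rightarrow> set_mset a), m - mset_set (case p of (a, b) \<Rightarrow> set_mset a)) = p"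
      using p a by auto
    show "(case p of (a, b) \<Rightarrow> set_mset a) \<in> Pow (set_mset m)" using p by auto
    have "size a = card (set_mset a)" using a by (metis size_mset_set)
    then show "(- 1) ^ card (case p of (a, b) \<Rightarrow> set_mset a) =
        (case p of (a, b) \<Rightarrow> (- 1 :: complex) ^ size a)" using p(1) by simp
  next
    fix S assume "S \<in> Pow (set_mset m)"
    then have S: "S \<subseteq> set_mset m" "finite S" by (auto intro: finite_subset)
    show "(case (mset_set S, m - mset_set S) of (a, b) \<Rightarrow> set_mset a) = S" using S by simp
    have "mset_set S \<subseteq># m"
      using S by (auto simp: subseteq_mset_def count_mset_set' Suc_le_eq)
    then show "(mset_set S, m - mset_set S) \<in> {(a, b) \<in> splits m. \<forall>i. count a i \<le> 1}"
      by (auto simp: splits_def count_mset_set')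
  qed
  finally show ?thesis by (simp add: sum_alternating_Pow)
qed

lemma sf_coeff_uminus: "sf_coeff (- f) m = - sf_coeff f m"
  by transfer simp

lemma sf_coeff_sign_mult: "sf_coeff ((- 1) ^ k * f) m = (- 1) ^ k * sf_coeff f m"
  by (induction k) (auto simp: sf_coeff_uminus)

lemma E_H_inverse: "(E_series oo (- fps_X)) * H_series = 1"
proof (rule fps_ext, rule symfun_eqI)
  fix n and m :: "nat multiset"
  let ?sq = "\<lambda>a :: nat multiset. \<forall>i. count a i \<le> 1"
  have "sf_coeff (((E_series oo (- fps_X)) * H_series) $ n) m =
      (\<Sum>k=0..n. (- 1) ^ k * (\<Sum>(a, b)\<in>splits m. sf_coeff (sf_e k) a * sf_coeff (sf_h (n - k)) b))"
    unfolding fps_mult_nth fps_compose_uminus' E_series_def H_series_nth fps_nth_Abs_fps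
      sf_coeff_sum mult.assoc sf_coeff_sign_mult by (simp only: sf_coeff_mult)
  also have "\<dots> = (\<Sum>k=0..n. \<Sum>p\<in>splits m.
      if k = size (fst p) then (if ?sq (fst p) \<and> size (snd p) = n - k then (- 1) ^ k else 0) else 0)"
    by (auto simp: sum_distrib_left case_prod_unfold sf_coeff_e sf_coeff_h intro!: sum.cong)
  also have "\<dots> = (\<Sum>p\<in>splits m. \<Sum>k=0..n.
      if k = size (fst p) then (if ?sq (fst p) \<and> size (snd p) = n - k then (- 1) ^ k else 0) else 0)"
    by (rule sum.swap)
  also have "\<dots> = (\<Sum>(a, b)\<in>splits m. if size m = n then (if ?sq a then (- 1) ^ size a else 0) else 0)"
    by (intro sum.cong) (auto simp: splits_def)
  also have "\<dots> = (if size m = n \<and> m = {#} then 1 else 0)"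
    using sum_squarefree_splits[of m] by (cases "size m = n") auto
  also have "\<dots> = sf_coeff (1 $ n) m"
    by (auto simp: sf_coeff_one sf_coeff_zero)
  finally show "sf_coeff (((E_series oo (- fps_X)) * H_series) $ n) m = sf_coeff (1 $ n) m" .
qed

text \<open>
  The lowest nonzero coefficient of \<open>T\<close>, in degree \<open>n\<close> say, survives in \<open>T * G n\<close>. This replaces the division
  by \<open>G n\<close>, which depends on the degree considered.
\<close>
lemma fps_eq_0_by_diagonal:
  fixes T :: "'a :: comm_ring_1 fps"
  assumes G0: "\<And>n. G n $ 0 = 1" and "\<And>n. (T * G n) $ n = 0"
  shows "T = 0"
proof (rule fps_ext)
  fix n
  show "T $ n = 0 $ n"
  proof (induction n rule: less_induct)
    case (less n)
    have "(T * G n) $ n = (\<Sum>i=0..n. T $ i * G n $ (n - i))" by (rule fps_mult_nth)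
    also have "\<dots> = (\<Sum>i\<in>{n}. T $ i * G n $ (n - i))"
      using less by (intro sum.mono_neutral_right) auto
    finally show ?case using assms by simp
  qed
qed

lemma parking_inverse_series:
  "(fps_X * parking_series) oo (fps_X * (E_series oo (- fps_X))) = fps_X"
proof -
  define E' where "E' = E_series oo (- fps_X)"
  define T where "T = Abs_fps (\<lambda>N. \<Sum>n=0..N. parking_series $ n * (E' ^ Suc n) $ (N - n))"
  have EH: "E' * H_series = 1" unfolding E'_def by (rule E_H_inverse)
  have H0: "H_series $ 0 = 1" by (simp add: sf_h_0)
  have "T - 1 = 0"
  proof (rule fps_eq_0_by_diagonal[where G = "\<lambda>n. H_series ^ Suc n"])
    show "(H_series ^ Suc n) $ 0 = 1" for n by (simp only: fps_nth_power_0 H0 power_one)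
    fix N
    define G where "G = H_series ^ Suc N"
    \<comment> \<open>Up to degree \<open>N\<close> the series \<open>T\<close> agrees with a finite sum, in which each term can be multiplied by \<open>G\<close> separately.\<close>
    define T' where "T' = (\<Sum>n=0..N. fps_const (parking_series $ n) * (fps_X ^ n * E' ^ Suc n))"
    have T': "T $ j = T' $ j" if "j \<le> N" for j
    proof -
      have "T' $ j = (\<Sum>n=0..N. if j < n then 0 else parking_series $ n * (E' ^ Suc n) $ (j - n))"
        unfolding T'_def fps_sum_nth by (intro sum.cong) (auto simp: fps_X_power_mult_nth simp del: power_Suc)
      also have "\<dots> = (\<Sum>n=0..j. parking_series $ n * (E' ^ Suc n) $ (j - n))"
        using that by (intro sum.mono_neutral_cong_right) auto
      finally show ?thesis by (simp add: T_def)
    qed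
    have "(T * G) $ N = (T' * G) $ N"
      unfolding fps_mult_nth by (intro sum.cong) (auto simp: T')
    also have "T' * G = (\<Sum>n=0..N. fps_const (parking_series $ n) * (fps_X ^ n * (E' ^ Suc n * G)))"
      unfolding T'_def sum_distrib_right by (simp only: mult.assoc)
    also have "\<dots> $ N = (\<Sum>n=0..N. parking_series $ n * (E' ^ Suc n * G) $ (N - n))"
      unfolding fps_sum_nth by (intro sum.cong) (auto simp: fps_X_power_mult_nth simp del: power_Suc)
    also have "\<dots> = (\<Sum>n=0..N. parking_series $ n * (H_series ^ (N - n)) $ (N - n))"
    proof (intro sum.cong refl)
      fix n assume "n \<in> {0..N}"
      then have "G = H_series ^ Suc n * H_series ^ (N - n)"
        unfolding G_def by (simp only: power_add[symmetric]) simp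
      then have "E' ^ Suc n * G = (E' * H_series) ^ Suc n * H_series ^ (N - n)"
        by (simp only: power_mult_distrib mult.assoc)
      then show "parking_series $ n * (E' ^ Suc n * G) $ (N - n) =
          parking_series $ n * (H_series ^ (N - n)) $ (N - n)"
        by (simp add: EH)
    qed
    also have "\<dots> = G $ N" unfolding G_def by (rule H_power_parking)
    finally show "((T - 1) * H_series ^ Suc N) $ N = 0"
      unfolding G_def by (simp only: left_diff_distrib fps_sub_nth mult_1_left diff_self)
  qed
  then have T1: "T = 1" by simp
  show ?thesis
  proof (rule fps_ext)
    fix k
    show "((fps_X * parking_series) oo (fps_X * (E_series oo (- fps_X)))) $ k = fps_X $ k"
    proof (cases k)
      case (Suc N)
      have "((fps_X * parking_series) oo (fps_X * E')) $ k =
          (\<Sum>i=0..Suc N. (fps_X * parking_series) $ i * ((fps_X * E') ^ i) $ Suc N)"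
        by (simp only: fps_compose_nth Suc)
      also have "\<dots> = (\<Sum>n=0..N. parking_series $ n * ((fps_X * E') ^ Suc n) $ Suc N)"
        by (subst sum.atLeast0_atMost_Suc_shift) (simp del: power_Suc)
      also have "\<dots> = T $ N"
        unfolding T_def by (auto simp: power_mult_distrib fps_X_power_mult_nth simp del: power_Suc intro!: sum.cong)
      finally show ?thesis using Suc T1 by (simp add: E'_def)
    qed simp
  qed
qed

section \<open>Permuting the positions of words\<close>

text \<open>
  The action on words transported to \<open>X\<close> along an encoding of the elements of \<open>X\<close> as words. The restriction to \<open>X\<close>
  makes the permutations extensional, as \<open>BijGroup\<close> demands.
\<close>
definition relabel_action ::
    "'x set \<Rightarrow> ('x \<Rightarrow> nat \<Rightarrow> 'a) \<Rightarrow> ((nat \<Rightarrow> 'a) \<Rightarrow> 'x) \<Rightarrow> (nat \<Rightarrow> nat) \<Rightarrow> 'x \<Rightarrow> 'x" where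
  "relabel_action X enc dec \<sigma> = (\<lambda>x\<in>X. dec (enc x \<circ> inv_into UNIV \<sigma>))"

locale word_encoding =
  fixes n :: nat and X :: "'x set" and W :: "(nat \<Rightarrow> 'a) set"
    and enc :: "'x \<Rightarrow> nat \<Rightarrow> 'a" and dec :: "(nat \<Rightarrow> 'a) \<Rightarrow> 'x"
  assumes enc: "\<And>x. x \<in> X \<Longrightarrow> enc x \<in> W" and dec: "\<And>w. w \<in> W \<Longrightarrow> dec w \<in> X"
    and dec_enc: "\<And>x. x \<in> X \<Longrightarrow> dec (enc x) = x" and enc_dec: "\<And>w. w \<in> W \<Longrightarrow> enc (dec w) = w"
    and closed: "\<And>w \<sigma>. w \<in> W \<Longrightarrow> \<sigma> permutes {1..n} \<Longrightarrow> w \<circ> \<sigma> \<in> W"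
begin

lemma closed_inv: "w \<in> W \<Longrightarrow> \<sigma> permutes {1..n} \<Longrightarrow> w \<circ> inv_into UNIV \<sigma> \<in> W"
  by (simp add: closed permutes_inv)

lemma relabel_closed:
  "x \<in> X \<Longrightarrow> \<sigma> permutes {1..n} \<Longrightarrow> relabel_action X enc dec \<sigma> x \<in> X"
  by (simp add: relabel_action_def enc dec closed_inv)

lemma relabel_compose:
  assumes "x \<in> X" "\<sigma> permutes {1..n}" "\<tau> permutes {1..n}"
  shows "relabel_action X enc dec (\<sigma> \<circ> \<tau>) x =
    relabel_action X enc dec \<sigma> (relabel_action X enc dec \<tau> x)"
proof -
  have "inv_into UNIV (\<sigma> \<circ> \<tau>) = inv_into UNIV \<tau> \<circ> inv_into UNIV \<sigma>"
    using assms by (simp add: o_inv_distrib permutes_bij)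
  then show ?thesis
    using assms by (simp add: relabel_action_def enc dec enc_dec closed_inv comp_assoc)
qed

lemma relabel_id: "x \<in> X \<Longrightarrow> relabel_action X enc dec id x = x"
  by (simp add: relabel_action_def dec_enc)

lemma relabel_Bij:
  assumes \<sigma>: "\<sigma> permutes {1..n}"
  shows "relabel_action X enc dec \<sigma> \<in> Bij X"
proof -
  let ?r = "relabel_action X enc dec"
  have inv: "inv_into UNIV \<sigma> permutes {1..n}" by (rule permutes_inv[OF \<sigma>])
  have "bij_betw (?r \<sigma>) X X"
  proof (rule bij_betwI[where g = "?r (inv_into UNIV \<sigma>)"])
    show "?r \<sigma> \<in> X \<rightarrow> X" "?r (inv_into UNIV \<sigma>) \<in> X \<rightarrow> X"
      using relabel_closed \<sigma> inv by auto
    show "?r (inv_into UNIV \<sigma>) (?r \<sigma> x) = x" if "x \<in> X" for x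
      using relabel_compose[OF that inv \<sigma>] relabel_id[OF that] permutes_inv_o[OF \<sigma>] by simp
    show "?r \<sigma> (?r (inv_into UNIV \<sigma>) x) = x" if "x \<in> X" for x
      using relabel_compose[OF that \<sigma> inv] relabel_id[OF that] permutes_inv_o[OF \<sigma>] by simp
  qed
  then show ?thesis by (simp add: Bij_def relabel_action_def)
qed

lemma group_action_relabel: "group_action (sym_group n) X (relabel_action X enc dec)"
proof -
  let ?r = "relabel_action X enc dec"
  have "?r \<in> hom (sym_group n) (BijGroup X)"
  proof (rule homI)
    fix \<sigma> \<tau> assume "\<sigma> \<in> carrier (sym_group n)" "\<tau> \<in> carrier (sym_group n)"
    then have st: "\<sigma> permutes {1..n}" "\<tau> permutes {1..n}" by (simp_all add: sym_group_carrier)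
    have "?r (\<sigma> \<circ> \<tau>) = compose X (?r \<sigma>) (?r \<tau>)"
    proof
      fix x show "?r (\<sigma> \<circ> \<tau>) x = compose X (?r \<sigma>) (?r \<tau>) x"
        using st by (cases "x \<in> X") (simp_all add: compose_def relabel_compose, simp add: relabel_action_def)
    qed
    then show "?r (\<sigma> \<otimes>\<^bsub>sym_group n\<^esub> \<tau>) = ?r \<sigma> \<otimes>\<^bsub>BijGroup X\<^esub> ?r \<tau>"
      using st by (simp add: sym_group_mult BijGroup_def relabel_Bij)
  qed (simp add: sym_group_carrier BijGroup_def relabel_Bij)
  then show ?thesis
    by (simp add: group_action_def group_hom_def group_hom_axioms_def sym_group_is_group group_BijGroup)
qed

lemma card_fixed_relabel:
  assumes \<sigma>: "\<sigma> permutes {1..n}"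
  shows "card {x \<in> X. relabel_action X enc dec \<sigma> x = x} = card {w \<in> W. w \<circ> \<sigma> = w}"
proof -
  have fixed_iff: "relabel_action X enc dec \<sigma> x = x \<longleftrightarrow> enc x \<circ> \<sigma> = enc x" if x: "x \<in> X" for x
  proof -
    have "relabel_action X enc dec \<sigma> x = x \<longleftrightarrow> enc x \<circ> inv_into UNIV \<sigma> = enc x"
    proof
      assume "relabel_action X enc dec \<sigma> x = x"
      then have "enc (dec (enc x \<circ> inv_into UNIV \<sigma>)) = enc x" using x by (simp add: relabel_action_def)
      then show "enc x \<circ> inv_into UNIV \<sigma> = enc x" using x \<sigma> by (simp only: enc_dec closed_inv enc)
    next
      assume "enc x \<circ> inv_into UNIV \<sigma> = enc x"
      then show "relabel_action X enc dec \<sigma> x = x" using x by (simp add: relabel_action_def dec_enc)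
    qed
    then show ?thesis by (simp add: word_fixed_inv_iff[OF \<sigma>])
  qed
  have "bij_betw enc {x \<in> X. relabel_action X enc dec \<sigma> x = x} {w \<in> W. w \<circ> \<sigma> = w}"
    by (rule bij_betwI[where g = dec]) (auto simp: fixed_iff enc dec enc_dec dec_enc)
  then show ?thesis by (rule bij_betw_same_card)
qed

end

lemma ch_relabel_block_words:
  assumes enc: "word_encoding n X (words n (block_content ` D)) enc dec"
    and D: "finite D" "inj_on block_content D" "\<And>ds. ds \<in> D \<Longrightarrow> sum_list ds = n"
  shows "ch_perm_module n X (relabel_action X enc dec) = (\<Sum>ds\<in>D. h_list ds)"
proof -
  interpret word_encoding n X "words n (block_content ` D)" enc dec by (fact enc)
  have "X = dec ` words n (block_content ` D)"
    using enc dec dec_enc by (force simp: image_iff)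
  then have "finite X" using finite_words[of "block_content ` D" n] D(1) by auto
  then have "ch_perm_module n X (relabel_action X enc dec) = (\<Sum>c\<in>block_content ` D. h_prod c)"
    using D card_fixed_relabel by (intro ch_words_module) auto
  also have "\<dots> = (\<Sum>ds\<in>D. h_list ds)"
    by (simp add: sum.reindex[OF D(2)] h_prod_block_content)
  finally show ?thesis .
qed

section \<open>Parking functions\<close>

lemma next_freeI:
  assumes "a \<le> t" "t \<le> n" "t \<notin> S" "\<And>s. a \<le> s \<Longrightarrow> s < t \<Longrightarrow> s \<in> S"
  shows "next_free n S a = Some t"
proof -
  have "(LEAST s. s \<in> {a..n} \<and> s \<notin> S) = t"
    using assms by (intro Least_equality) (auto simp: not_less[symmetric])
  then show ?thesis using assms(1-3) by (auto simp: next_free_def)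
qed

lemma next_free_SomeD:
  assumes "next_free n S a = Some t"
  shows "a \<le> t" "t \<le> n" "t \<notin> S" "\<And>s. a \<le> s \<Longrightarrow> s < t \<Longrightarrow> s \<in> S"
proof -
  let ?P = "\<lambda>s. s \<in> {a..n} \<and> s \<notin> S"
  have ex: "\<exists>s. ?P s" and t: "t = (LEAST s. ?P s)"
    using assms by (auto simp: next_free_def split: if_splits)
  have "?P t" unfolding t using ex by (rule LeastI_ex)
  then show bounds: "a \<le> t" "t \<le> n" "t \<notin> S" by auto
  show "s \<in> S" if "a \<le> s" "s < t" for s
    using not_less_Least[of s ?P] that bounds unfolding t[symmetric] by auto
qed

lemma next_free_NoneD: "next_free n S a = None \<Longrightarrow> s \<in> {a..n} \<Longrightarrow> s \<in> S"
  by (auto simp: next_free_def split: if_splits)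

lemma finite_occupied [simp]: "finite (occupied n \<alpha> k)"
  by (induction k) auto

lemma occupied_subset:
  assumes "\<And>i. i \<in> {1..k} \<Longrightarrow> 1 \<le> \<alpha> i"
  shows "occupied n \<alpha> k \<subseteq> {1..n}"
  using assms
proof (induction k)
  case (Suc k)
  have "set_option (next_free n (occupied n \<alpha> k) (\<alpha> (Suc k))) \<subseteq> {1..n}"
    using Suc.prems[of "Suc k"] next_free_SomeD(1,2)[of n "occupied n \<alpha> k" "\<alpha> (Suc k)"]
    by (fastforce simp: elem_set)
  then show ?case using Suc by simp
qed simp

lemma occupied_conv_car_spot: "occupied n \<alpha> k = (\<Union>i\<in>{1..k}. set_option (car_spot n \<alpha> i))"
  by (induction k) (auto simp: car_spot_def atLeastAtMostSuc_conv)

lemma car_spot_notin_occupied: "car_spot n \<alpha> i = Some t \<Longrightarrow> t \<notin> occupied n \<alpha> (i - 1)"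
  unfolding car_spot_def by (rule next_free_SomeD(3))

lemma inj_car_spot:
  assumes "i \<in> {1..n}" "j \<in> {1..n}" "car_spot n \<alpha> i = Some t" "car_spot n \<alpha> j = Some t"
  shows "i = j"
proof -
  have False if "i < j" "1 \<le> i" "car_spot n \<alpha> i = Some t" "car_spot n \<alpha> j = Some t" for i j
  proof -
    have "t \<in> occupied n \<alpha> (j - 1)"
      using that by (auto simp: occupied_conv_car_spot)
    then show False using car_spot_notin_occupied[OF that(4)] by simp
  qed
  then show ?thesis using assms by (cases i j rule: linorder_cases) auto
qed

lemma car_spot_bij:
  assumes "\<alpha> \<in> PF n"
  shows "bij_betw (\<lambda>i. the (car_spot n \<alpha> i)) {1..n} {1..n}"
proof -
  have spot: "car_spot n \<alpha> i = Some (the (car_spot n \<alpha> i))" if "i \<in> {1..n}" for i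
    using assms that by (auto simp: PF_def)
  have "inj_on (\<lambda>i. the (car_spot n \<alpha> i)) {1..n}"
  proof (rule inj_onI)
    fix i j assume i: "i \<in> {1..n}" and j: "j \<in> {1..n}"
      and "the (car_spot n \<alpha> i) = the (car_spot n \<alpha> j)"
    then show "i = j" using inj_car_spot[OF i j spot[OF i]] spot[OF j] by simp
  qed
  moreover have "(\<lambda>i. the (car_spot n \<alpha> i)) ` {1..n} \<subseteq> {1..n}"
  proof clarify
    fix i assume i: "i \<in> {1..n}"
    have "1 \<le> \<alpha> i" using assms i by (auto simp: PF_def PiE_iff)
    then show "the (car_spot n \<alpha> i) \<in> {1..n}"
      using next_free_SomeD(1,2)[OF spot[OF i, unfolded car_spot_def]] by (auto simp: car_spot_def)
  qed
  ultimately show ?thesis by (simp add: bij_betw_def endo_inj_surj)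
qed

lemma card_Suc_filter:
  "card {i \<in> {1..Suc k}. P i} = card {i \<in> {1..k}. P i} + (if P (Suc k) then 1 else 0)"
proof -
  have "{i \<in> {1..Suc k}. P i} = {i \<in> {1..k}. P i} \<union> (if P (Suc k) then {Suc k} else {})"
    by (auto simp: le_Suc_eq)
  then show ?thesis by (auto simp: card_insert_if)
qed

text \<open>
  A car that prefers a spot \<open>\<le> s\<close> never drives past \<open>s\<close> while \<open>s\<close> is free, so it parks strictly before \<open>s\<close>.
\<close>
lemma no_car_crosses_free_spot:
  assumes "s \<notin> occupied n \<alpha> k" "s \<le> n"
  shows "card {i \<in> {1..k}. \<alpha> i \<le> s} \<le> card {t \<in> occupied n \<alpha> k. t < s}"
  using assms(1)
proof (induction k)
  case (Suc k)
  let ?O = "occupied n \<alpha> k"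
  have IH: "card {i \<in> {1..k}. \<alpha> i \<le> s} \<le> card {t \<in> ?O. t < s}" using Suc by simp
  show ?case
  proof (cases "\<alpha> (Suc k) \<le> s")
    case True
    obtain t where t: "next_free n ?O (\<alpha> (Suc k)) = Some t"
      using next_free_NoneD[of n ?O "\<alpha> (Suc k)" s] True assms(2) Suc.prems by fastforce
    have "t \<le> s"
      using next_free_SomeD(4)[OF t True] Suc.prems by (auto simp: not_less[symmetric])
    moreover have "t \<noteq> s" using Suc.prems t by auto
    ultimately have "{u \<in> occupied n \<alpha> (Suc k). u < s} = insert t {u \<in> ?O. u < s}"
      using t by auto
    then show ?thesis using IH True next_free_SomeD(3)[OF t] unfolding card_Suc_filter by simp
  next
    case False
    have "card {u \<in> ?O. u < s} \<le> card {u \<in> occupied n \<alpha> (Suc k). u < s}"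
      by (intro card_mono) auto
    then show ?thesis using IH False unfolding card_Suc_filter by simp
  qed
qed simp

text \<open>
  If all cars park, spots \<open>1, \<dots>, j\<close> are filled by cars preferring a spot \<open>\<le> j\<close>. Conversely, a spot \<open>s\<close>
  that stayed empty would leave only the \<open>s - 1\<close> spots before it for the at least \<open>s\<close> cars preferring a spot
  \<open>\<le> s\<close>; if no spot stays empty, all \<open>n\<close> cars have parked.
\<close>
lemma PF_iff_counts:
  "\<alpha> \<in> PF n \<longleftrightarrow> \<alpha> \<in> {1..n} \<rightarrow>\<^sub>E {1..n} \<and> (\<forall>j\<le>n. j \<le> card {i \<in> {1..n}. \<alpha> i \<le> j})"
proof (intro iffI conjI)
  assume \<alpha>: "\<alpha> \<in> PF n"
  then show "\<alpha> \<in> {1..n} \<rightarrow>\<^sub>E {1..n}" by (simp add: PF_def)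
  show "\<forall>j\<le>n. j \<le> card {i \<in> {1..n}. \<alpha> i \<le> j}"
  proof (intro allI impI)
    fix j assume j: "j \<le> n"
    let ?spot = "\<lambda>i. the (car_spot n \<alpha> i)"
    have "{1..j} \<subseteq> ?spot ` {i \<in> {1..n}. \<alpha> i \<le> j}"
    proof
      fix s assume s: "s \<in> {1..j}"
      then obtain i where i: "i \<in> {1..n}" "s = ?spot i"
        using bij_betw_imp_surj_on[OF car_spot_bij[OF \<alpha>]] j by (metis (no_types, lifting) atLeastAtMost_iff imageE le_trans)
      then have "car_spot n \<alpha> i = Some s" using \<alpha> by (auto simp: PF_def)
      then have "\<alpha> i \<le> s" unfolding car_spot_def by (rule next_free_SomeD(1))
      then show "s \<in> ?spot ` {i \<in> {1..n}. \<alpha> i \<le> j}" using i s by auto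
    qed
    then have "card {1..j} \<le> card (?spot ` {i \<in> {1..n}. \<alpha> i \<le> j})" by (intro card_mono) auto
    also have "\<dots> \<le> card {i \<in> {1..n}. \<alpha> i \<le> j}" by (intro card_image_le) auto
    finally show "j \<le> card {i \<in> {1..n}. \<alpha> i \<le> j}" by simp
  qed
next
  assume H: "\<alpha> \<in> {1..n} \<rightarrow>\<^sub>E {1..n} \<and> (\<forall>j\<le>n. j \<le> card {i \<in> {1..n}. \<alpha> i \<le> j})"
  have sub: "occupied n \<alpha> n \<subseteq> {1..n}" using H by (intro occupied_subset) (auto simp: PiE_iff)
  have "{1..n} \<subseteq> occupied n \<alpha> n"
  proof (rule ccontr)
    assume "\<not> {1..n} \<subseteq> occupied n \<alpha> n"
    then obtain s where s: "s \<in> {1..n}" "s \<notin> occupied n \<alpha> n" by blast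
    have "s \<le> card {i \<in> {1..n}. \<alpha> i \<le> s}" using H s by auto
    also have "\<dots> \<le> card {t \<in> occupied n \<alpha> n. t < s}"
      using s by (intro no_car_crosses_free_spot) auto
    also have "\<dots> \<le> card {1..<s}" using sub by (intro card_mono) auto
    finally have "s \<le> s - 1" by simp
    then show False using s(1) by (cases s) auto
  qed
  then have "n \<le> card (occupied n \<alpha> n)" using card_mono[of "occupied n \<alpha> n" "{1..n}"] by simp
  also have "occupied n \<alpha> n \<subseteq> (\<lambda>i. the (car_spot n \<alpha> i)) ` {i \<in> {1..n}. car_spot n \<alpha> i \<noteq> None}"
    by (force simp: occupied_conv_car_spot elem_set)
  then have "card (occupied n \<alpha> n) \<le> card {i \<in> {1..n}. car_spot n \<alpha> i \<noteq> None}"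
    by (intro surj_card_le) auto
  finally have "{i \<in> {1..n}. car_spot n \<alpha> i \<noteq> None} = {1..n}"
    by (intro card_seteq) auto
  then show "\<alpha> \<in> PF n" using H by (auto simp: PF_def)
qed

lemma size_filter_content: "size (filter_mset P (content n f)) = card {i \<in> {1..n}. P (f i)}"
  by (simp add: content_def filter_mset_image_mset)

lemma PF_eq_words: "PF n = words n (block_content ` parking_compositions n)"
proof (intro equalityI subsetI)
  fix \<alpha> assume "\<alpha> \<in> PF n"
  then have word: "\<alpha> \<in> {1..n} \<rightarrow>\<^sub>E {1..n}" and counts: "\<forall>j\<le>n. j \<le> card {i \<in> {1..n}. \<alpha> i \<le> j}"
    by (simp_all add: PF_iff_counts)
  define ds where "ds = map (count (content n \<alpha>)) [1..<n + 1]"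
  have bc: "block_content ds = content n \<alpha>"
    unfolding ds_def using word by (intro block_content_counts) auto
  have "sum_list ds = n" by (simp flip: size_block_content add: bc)
  moreover have "j \<le> sum_list (take j ds)" if "j \<le> n" for j
    using counts that by (simp flip: size_filter_block_content add: bc size_filter_content)
  moreover have "length ds = n" by (simp add: ds_def)
  ultimately have "ds \<in> parking_compositions n"
    by (simp add: parking_compositions_def weak_compositions_def)
  then show "\<alpha> \<in> words n (block_content ` parking_compositions n)"
    using word bc by (force simp: words_def)
next
  fix \<alpha> assume "\<alpha> \<in> words n (block_content ` parking_compositions n)"
  then obtain ds where ds: "ds \<in> parking_compositions n" "content n \<alpha> = block_content ds"
    and word: "\<alpha> \<in> {1..n} \<rightarrow>\<^sub>E UNIV" by (auto simp: words_def)
  have "\<alpha> ` {1..n} \<subseteq> {1..n}"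
    using set_block_content[of ds] ds set_content[of n \<alpha>]
    by (simp only: parking_compositions_def weak_compositions_def mem_Collect_eq)
  moreover have "j \<le> card {i \<in> {1..n}. \<alpha> i \<le> j}" if "j \<le> n" for j
    unfolding size_filter_content[of "\<lambda>x. x \<le> j" n \<alpha>, symmetric]
    using ds that by (simp add: size_filter_block_content parking_compositions_def)
  ultimately show "\<alpha> \<in> PF n" using word by (auto simp: PF_iff_counts)
qed

lemma PF_action_eq: "PF_action n = relabel_action (PF n) id id"
  by (simp add: PF_action_def relabel_action_def fun_eq_iff)

lemma word_encoding_PF: "word_encoding n (PF n) (words n (block_content ` parking_compositions n)) id id"
  using words_closed by unfold_locales (auto simp: PF_eq_words)

lemma ch_PF: "ch_perm_module n (PF n) (PF_action n) = (\<Sum>ds\<in>parking_compositions n. h_list ds)"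
  unfolding PF_action_eq using word_encoding_PF
proof (rule ch_relabel_block_words)
  show "inj_on block_content (parking_compositions n)"
    by (rule inj_onI, rule block_content_inject) (auto simp: parking_compositions_def weak_compositions_def)
qed (simp, simp add: parking_compositions_def weak_compositions_def)

section \<open>Standardization of words\<close>

text \<open>
  The standardization of \<open>w\<close>: the rank of position \<open>i\<close> when positions are sorted by letter, and equal
  letters from left to right.
\<close>
definition slot :: "nat \<Rightarrow> (nat \<Rightarrow> nat) \<Rightarrow> nat \<Rightarrow> nat" where
  "slot n w i = card {j \<in> {1..n}. w j < w i \<or> w j = w i \<and> j \<le> i}"

definition is_first :: "(nat \<Rightarrow> nat) \<Rightarrow> nat \<Rightarrow> bool" where
  "is_first w i \<longleftrightarrow> (\<forall>j\<in>{1..<i}. w j \<noteq> w i)"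

lemma slot_less:
  assumes "j \<in> {1..n}" "w i < w j \<or> w i = w j \<and> i < j"
  shows "slot n w i < slot n w j"
proof -
  let ?A = "\<lambda>i. {l \<in> {1..n}. w l < w i \<or> w l = w i \<and> l \<le> i}"
  have "?A i \<subseteq> ?A j"
  proof
    fix l assume "l \<in> ?A i"
    then show "l \<in> ?A j" using assms(2) by auto
  qed
  moreover have "j \<in> ?A j" "j \<notin> ?A i" using assms by auto
  ultimately have "?A i \<subset> ?A j" by blast
  then show ?thesis unfolding slot_def by (intro psubset_card_mono) auto
qed

lemma slot_le_iff:
  assumes "i \<in> {1..n}" "j \<in> {1..n}"
  shows "slot n w i \<le> slot n w j \<longleftrightarrow> w i < w j \<or> w i = w j \<and> i \<le> j"
proof -
  consider "w i < w j \<or> w i = w j \<and> i < j" | "i = j" | "w j < w i \<or> w j = w i \<and> j < i"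
    by linarith
  then show ?thesis
  proof cases
    case 1
    then show ?thesis using slot_less[OF assms(2), of w i] by auto
  next
    case 3
    then show ?thesis using slot_less[OF assms(1), of w j] by auto
  qed simp
qed

lemma slot_bij: "bij_betw (slot n w) {1..n} {1..n}"
proof -
  have "inj_on (slot n w) {1..n}"
  proof (rule inj_onI)
    fix i j assume "i \<in> {1..n}" "j \<in> {1..n}" "slot n w i = slot n w j"
    then show "i = j" using slot_le_iff[of i n j w] slot_le_iff[of j n i w] by auto
  qed
  moreover have "slot n w i \<in> {1..n}" if "i \<in> {1..n}" for i
  proof -
    have "slot n w i \<le> card {1..n}" unfolding slot_def by (intro card_mono) auto
    moreover have "slot n w i > 0" unfolding slot_def using that by (subst card_gt_0_iff) auto
    ultimately show ?thesis by simp
  qed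
  ultimately show ?thesis by (simp add: bij_betw_def endo_inj_surj image_subset_iff)
qed

lemma slot_in_range: "i \<in> {1..n} \<Longrightarrow> slot n w i \<in> {1..n}"
  using bij_betwE[OF slot_bij] by blast

lemma slot_eq_iff:
  "i \<in> {1..n} \<Longrightarrow> j \<in> {1..n} \<Longrightarrow> slot n w i = slot n w j \<longleftrightarrow> i = j"
  by (rule inj_on_eq_iff[OF bij_betw_imp_inj_on[OF slot_bij]])

text \<open>
  The position just before \<open>i\<close> in the standardization is the previous occurrence of the same letter.
\<close>
lemma not_first_predecessor:
  assumes i: "i \<in> {1..n}" and "\<not> is_first w i"
  obtains j where "j \<in> {1..<i}" "w j = w i" "slot n w i = Suc (slot n w j)"
proof -
  let ?J = "{j \<in> {1..<i}. w j = w i}"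
  define j where "j = Max ?J"
  have "?J \<noteq> {}" using assms(2) by (auto simp: is_first_def)
  then have j: "j \<in> ?J" unfolding j_def by (intro Max_in) auto
  have max: "l \<le> j" if "l \<in> ?J" for l
    unfolding j_def using that by (intro Max_ge) auto
  have "{l \<in> {1..n}. w l < w i \<or> w l = w i \<and> l \<le> i} =
      insert i {l \<in> {1..n}. w l < w j \<or> w l = w j \<and> l \<le> j}"
    using i j max by (auto simp: le_less)
  then have "slot n w i = Suc (slot n w j)"
    unfolding slot_def using j by simp
  then show ?thesis using that j by auto
qed

section \<open>Unit interval parking functions as packed words\<close>

text \<open>
  Car \<open>i\<close> is to park in \<open>slot n w i\<close>. The first car of a block prefers this spot, and every later car
  prefers the preceding one, which the previous car of its block occupies.
\<close>
definition upf_of_word :: "nat \<Rightarrow> (nat \<Rightarrow> nat) \<Rightarrow> nat \<Rightarrow> nat" where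
  "upf_of_word n w = (\<lambda>i\<in>{1..n}. if is_first w i then slot n w i else slot n w i - 1)"

definition lucky :: "nat \<Rightarrow> (nat \<Rightarrow> nat) \<Rightarrow> nat \<Rightarrow> bool" where
  "lucky n \<alpha> i \<longleftrightarrow> car_spot n \<alpha> i = Some (\<alpha> i)"

text \<open>
  The blocks begin at the spots of the lucky cars, so this is the number of the block containing the value
  \<open>\<alpha> i\<close>.
\<close>
definition word_of_upf :: "nat \<Rightarrow> (nat \<Rightarrow> nat) \<Rightarrow> nat \<Rightarrow> nat" where
  "word_of_upf n \<alpha> = (\<lambda>i\<in>{1..n}. card {l \<in> {1..n}. lucky n \<alpha> l \<and> \<alpha> l \<le> \<alpha> i})"

definition packed_words :: "nat \<Rightarrow> (nat \<Rightarrow> nat) set" where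
  "packed_words n = {w \<in> {1..n} \<rightarrow>\<^sub>E UNIV. \<exists>k. w ` {1..n} = {1..k}}"

lemma packed_words_eq: "packed_words n = words n (block_content ` compositions n)"
proof (intro equalityI subsetI)
  fix w assume "w \<in> packed_words n"
  then obtain k where w: "w \<in> {1..n} \<rightarrow>\<^sub>E UNIV" "w ` {1..n} = {1..k}"
    by (auto simp: packed_words_def)
  define ds where "ds = map (count (content n w)) [1..<k + 1]"
  have bc: "block_content ds = content n w"
    unfolding ds_def using w by (intro block_content_counts) simp
  have "0 \<notin> set ds"
  proof
    assume "0 \<in> set ds"
    then have "0 \<in> count (content n w) ` {1..k}"
      by (simp add: ds_def atLeastLessThanSuc_atLeastAtMost del: upt_Suc)
    then obtain j where "j \<in> {1..k}" "count (content n w) j = 0" by (metis imageE)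
    then have "j \<notin> w ` {1..n}" by (simp only: count_eq_zero_iff set_content not_False_eq_True)
    then show False using w(2) \<open>j \<in> {1..k}\<close> by blast
  qed
  moreover have "sum_list ds = n" by (simp flip: size_block_content add: bc)
  ultimately have "ds \<in> compositions n" by (simp add: compositions_def)
  then show "w \<in> words n (block_content ` compositions n)"
    using w bc by (force simp: words_def)
next
  fix w assume "w \<in> words n (block_content ` compositions n)"
  then obtain ds where ds: "0 \<notin> set ds" "content n w = block_content ds" and w: "w \<in> {1..n} \<rightarrow>\<^sub>E UNIV"
    by (auto simp: words_def compositions_def)
  have "set_mset (block_content ds) = {1..length ds}"
  proof (rule antisym[OF set_block_content], rule subsetI)
    fix j assume "j \<in> {1..length ds}"
    then have "count (block_content ds) j \<in> set ds" by (auto simp: count_block_content)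
    then show "j \<in># block_content ds" using ds(1) by (metis not_in_iff)
  qed
  then have "w ` {1..n} = {1..length ds}" using ds(2) set_content[of n w] by simp
  then show "w \<in> packed_words n" using w by (auto simp: packed_words_def)
qed

lemma block_content_inj_on_compositions: "inj_on block_content (compositions n)"
proof (rule inj_onI)
  fix ds es assume "ds \<in> compositions n" "es \<in> compositions n" and eq: "block_content ds = block_content es"
  then have "0 \<notin> set ds" "0 \<notin> set es" by (auto simp: compositions_def)
  then have "d \<in> {1..length ds} \<longleftrightarrow> d \<in> {1..length es}" for d
    using eq count_block_content[of ds d] count_block_content[of es d]
    by (metis (no_types, lifting) atLeastAtMost_iff diff_Suc_less less_le_trans not_le nth_mem
        One_nat_def Suc_le_eq diff_less zero_less_one)
  then have "{1..length ds} = {1..length es}" by blast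
  then have "length ds = length es" by (metis card_atLeastAtMost diff_Suc_1)
  then show "ds = es" using eq by (rule block_content_inject)
qed

lemma upf_of_word_range:
  assumes "i \<in> {1..n}"
  shows "upf_of_word n w i \<in> {1..n}"
    and "slot n w i \<in> {upf_of_word n w i, upf_of_word n w i + 1}"
    and "slot n w i = upf_of_word n w i \<longleftrightarrow> is_first w i"
proof -
  have s: "slot n w i \<in> {1..n}" using slot_in_range assms by blast
  have "slot n w i \<ge> 2" if not_first: "\<not> is_first w i"
  proof -
    obtain j where j: "j \<in> {1..<i}" "slot n w i = Suc (slot n w j)"
      using not_first_predecessor[OF assms not_first] by metis
    then have "slot n w j \<in> {1..n}" using assms by (intro slot_in_range) auto
    then show ?thesis using j by simp
  qed
  then show "upf_of_word n w i \<in> {1..n}"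
    and "slot n w i \<in> {upf_of_word n w i, upf_of_word n w i + 1}"
    and "slot n w i = upf_of_word n w i \<longleftrightarrow> is_first w i"
    using s assms by (auto simp: upf_of_word_def)
qed

text \<open>
  If car \<open>k + 1\<close> is not the first of its block, the spot it prefers was taken by the previous car of the block, and
  the next spot is still free because standardization is injective.
\<close>
lemma next_free_upf_of_word:
  assumes "Suc k \<le> n"
  shows "next_free n (slot n w ` {1..k}) (upf_of_word n w (Suc k)) = Some (slot n w (Suc k))"
proof -
  let ?i = "Suc k"
  have i: "?i \<in> {1..n}" using assms by simp
  have free: "slot n w ?i \<notin> slot n w ` {1..k}"
  proof
    assume "slot n w ?i \<in> slot n w ` {1..k}"
    then obtain j where j: "j \<in> {1..k}" "slot n w ?i = slot n w j" by blast
    then have "j \<in> {1..n}" using assms by auto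
    then show False using slot_eq_iff[OF i, of j w] j by simp
  qed
  have le: "slot n w ?i \<le> n" using slot_in_range[OF i, of w] by simp
  show ?thesis
  proof (cases "is_first w ?i")
    case True
    then have "upf_of_word n w ?i = slot n w ?i" using upf_of_word_range(3)[OF i, of w] by simp
    then show ?thesis using free le by (intro next_freeI) auto
  next
    case False
    then obtain j where j: "j \<in> {1..<?i}" "slot n w ?i = Suc (slot n w j)"
      using not_first_predecessor[OF i False] by metis
    then have "upf_of_word n w ?i = slot n w j"
      using False i by (simp add: upf_of_word_def)
    then show ?thesis using free le j by (intro next_freeI) (auto simp: less_Suc_eq)
  qed
qed

lemma occupied_upf_of_word: "k \<le> n \<Longrightarrow> occupied n (upf_of_word n w) k = slot n w ` {1..k}"
proof (induction k)
  case (Suc k)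
  then show ?case using next_free_upf_of_word[of k n w] by (simp add: atLeastAtMostSuc_conv)
qed simp

lemma car_spot_upf_of_word:
  assumes "i \<in> {1..n}"
  shows "car_spot n (upf_of_word n w) i = Some (slot n w i)"
proof -
  obtain k where "i = Suc k" "Suc k \<le> n" using assms by (cases i) auto
  then show ?thesis
    using next_free_upf_of_word[of k n w] occupied_upf_of_word[of k n w] by (simp add: car_spot_def)
qed

lemma lucky_upf_of_word:
  assumes "i \<in> {1..n}"
  shows "lucky n (upf_of_word n w) i \<longleftrightarrow> is_first w i"
  using upf_of_word_range(3)[OF assms] by (simp add: lucky_def car_spot_upf_of_word[OF assms])

lemma upf_of_word_in_UPF: "upf_of_word n w \<in> UPF n"
proof -
  have "upf_of_word n w \<in> {1..n} \<rightarrow>\<^sub>E {1..n}"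
  proof (rule PiE_I)
    show "upf_of_word n w i \<in> {1..n}" if "i \<in> {1..n}" for i using that by (rule upf_of_word_range(1))
  qed (simp only: upf_of_word_def restrict_apply if_False)
  then show ?thesis
    using upf_of_word_range(2)[of _ n w] unfolding UPF_def PF_def
    by (simp add: car_spot_upf_of_word del: One_nat_def)
qed

text \<open>
  A block occupies an interval of spots beginning with the spot of its first car, and the values of the
  entries lie in this interval; so comparing an entry with the start of a block compares block numbers.
\<close>
lemma first_le_iff:
  assumes l: "l \<in> {1..n}" "is_first w l" and i: "i \<in> {1..n}"
  shows "upf_of_word n w l \<le> upf_of_word n w i \<longleftrightarrow> w l \<le> w i"
proof -
  have al: "upf_of_word n w l = slot n w l" using l by (simp add: upf_of_word_def)
  show ?thesis
  proof
    assume "upf_of_word n w l \<le> upf_of_word n w i"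
    then have "slot n w l \<le> slot n w i" using upf_of_word_range(2)[OF i, of w] al by auto
    then show "w l \<le> w i" using slot_le_iff[OF l(1) i] by auto
  next
    assume le: "w l \<le> w i"
    show "upf_of_word n w l \<le> upf_of_word n w i"
    proof (cases "l = i")
      case False
      have "l < i \<or> w l < w i"
      proof (rule ccontr)
        assume "\<not> (l < i \<or> w l < w i)"
        then have "i \<in> {1..<l}" "w i = w l" using le False i by auto
        then show False using l(2) by (auto simp: is_first_def)
      qed
      show ?thesis
      proof (cases "is_first w i")
        case True
        have "\<not> (w l = w i \<and> l < i)" using True l(1) by (auto simp: is_first_def)
        then have "slot n w l \<le> slot n w i"
          unfolding slot_le_iff[OF l(1) i] using le \<open>l < i \<or> w l < w i\<close> by linarith
        then show ?thesis using True al i by (simp add: upf_of_word_def)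
      next
        case False
        have "w l < w i \<or> w l = w i \<and> l < i"
          using le \<open>l < i \<or> w l < w i\<close> by linarith
        then have "slot n w l < slot n w i" by (rule slot_less[OF i])
        then show ?thesis using False al i by (simp add: upf_of_word_def)
      qed
    qed simp
  qed
qed

lemma ex_first:
  assumes "i \<in> {1..n}"
  obtains l where "l \<in> {1..n}" "is_first w l" "w l = w i"
proof -
  let ?P = "\<lambda>l. l \<in> {1..n} \<and> w l = w i"
  define l where "l = (LEAST l. ?P l)"
  have l: "?P l" unfolding l_def using assms by (intro LeastI[of ?P i]) auto
  have "w j \<noteq> w l" if "j \<in> {1..<l}" for j
    using not_less_Least[of j ?P] that l unfolding l_def[symmetric] by auto
  then have "is_first w l" by (simp add: is_first_def)
  then show ?thesis using l by (intro that[of l]) auto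
qed

text \<open>Each of the letters \<open>1, \<dots>, w i\<close> occurs, because \<open>w\<close> is packed, and has exactly one first occurrence.\<close>
lemma card_firsts_le:
  assumes w: "w \<in> packed_words n" and i: "i \<in> {1..n}"
  shows "card {l \<in> {1..n}. is_first w l \<and> w l \<le> w i} = w i"
proof -
  obtain k where k: "w ` {1..n} = {1..k}" using w by (auto simp: packed_words_def)
  have "inj_on w {l \<in> {1..n}. is_first w l \<and> w l \<le> w i}"
  proof (rule inj_onI)
    fix a b assume "a \<in> {l \<in> {1..n}. is_first w l \<and> w l \<le> w i}" "b \<in> {l \<in> {1..n}. is_first w l \<and> w l \<le> w i}" "w a = w b"
    then show "a = b" by (cases a b rule: linorder_cases) (auto simp: is_first_def)
  qed
  moreover have "w ` {l \<in> {1..n}. is_first w l \<and> w l \<le> w i} = {1..w i}"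
  proof (intro equalityI subsetI)
    fix b assume "b \<in> {1..w i}"
    moreover have "w i \<in> {1..k}" using i k by blast
    ultimately have "b \<in> w ` {1..n}" unfolding k by auto
    then obtain j where "j \<in> {1..n}" "w j = b" by auto
    then obtain l where "l \<in> {1..n}" "is_first w l" "w l = b" using ex_first[of j n w] by metis
    then show "b \<in> w ` {l \<in> {1..n}. is_first w l \<and> w l \<le> w i}" using \<open>b \<in> {1..w i}\<close> by auto
  next
    fix b assume b: "b \<in> w ` {l \<in> {1..n}. is_first w l \<and> w l \<le> w i}"
    then have "b \<in> w ` {1..n}" by blast
    then show "b \<in> {1..w i}" using b unfolding k by auto
  qed
  ultimately show ?thesis using card_image by fastforce
qed

lemma lucky_set_upf_of_word:
  assumes "i \<in> {1..n}"
  shows "{l \<in> {1..n}. lucky n (upf_of_word n w) l \<and> upf_of_word n w l \<le> upf_of_word n w i} =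
    {l \<in> {1..n}. is_first w l \<and> w l \<le> w i}"
  using first_le_iff[OF _ _ assms, of _ w] lucky_upf_of_word[of _ n w] by blast

lemma word_of_upf_of_word:
  assumes "w \<in> packed_words n"
  shows "word_of_upf n (upf_of_word n w) = w"
proof (rule PiE_ext[of _ "{1..n}" "\<lambda>_. UNIV"])
  show "word_of_upf n (upf_of_word n w) \<in> {1..n} \<rightarrow>\<^sub>E UNIV" by (simp add: word_of_upf_def)
  show "w \<in> {1..n} \<rightarrow>\<^sub>E UNIV" using assms by (simp add: packed_words_def)
  fix i assume "i \<in> {1..n}"
  then show "word_of_upf n (upf_of_word n w) i = w i"
    using lucky_set_upf_of_word card_firsts_le[OF assms] by (simp add: word_of_upf_def)
qed

text \<open>
  Cars are viewed by the spot they end in. The level of a spot is the number of lucky spots up to it, that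
  is, the number of the block that contains it.
\<close>
locale unit_interval_pf =
  fixes n :: nat and \<alpha> :: "nat \<Rightarrow> nat"
  assumes UPF: "\<alpha> \<in> UPF n"
begin

definition spot :: "nat \<Rightarrow> nat" where "spot i = the (car_spot n \<alpha> i)"

definition level :: "nat \<Rightarrow> nat" where
  "level x = card {l \<in> {1..n}. lucky n \<alpha> l \<and> spot l \<le> x}"

lemma PF: "\<alpha> \<in> PF n" using UPF by (simp add: UPF_def)

lemma pref_range: "i \<in> {1..n} \<Longrightarrow> \<alpha> i \<in> {1..n}"
  using PF by (auto simp: PF_def)

lemma car_spot: "i \<in> {1..n} \<Longrightarrow> car_spot n \<alpha> i = Some (spot i)"
  using PF by (auto simp: PF_def spot_def)

lemma spot_bij: "bij_betw spot {1..n} {1..n}"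
  unfolding spot_def using PF by (rule car_spot_bij)

lemma spot_in_range: "i \<in> {1..n} \<Longrightarrow> spot i \<in> {1..n}"
  using bij_betwE[OF spot_bij] by blast

lemma spot_eq_iff: "i \<in> {1..n} \<Longrightarrow> j \<in> {1..n} \<Longrightarrow> spot i = spot j \<longleftrightarrow> i = j"
  by (rule inj_on_eq_iff[OF bij_betw_imp_inj_on[OF spot_bij]])

lemma lucky_iff: "i \<in> {1..n} \<Longrightarrow> lucky n \<alpha> i \<longleftrightarrow> spot i = \<alpha> i"
  by (simp add: lucky_def car_spot)

lemma unlucky_spot:
  assumes "i \<in> {1..n}" "\<not> lucky n \<alpha> i"
  shows "spot i = Suc (\<alpha> i)"
proof -
  have "car_spot n \<alpha> i \<in> {Some (\<alpha> i), Some (\<alpha> i + 1)}"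
    using UPF assms(1) unfolding UPF_def by blast
  then show ?thesis using assms car_spot[OF assms(1)] by (auto simp: lucky_def)
qed

text \<open>
  An unlucky car found its preferred spot taken, and it parks in the next one; so the spot to its left belongs to
  an earlier car.
\<close>
lemma unlucky_predecessor:
  assumes i: "i \<in> {1..n}" and unlucky: "\<not> lucky n \<alpha> i"
  obtains j where "j \<in> {1..<i}" "Suc (spot j) = spot i"
proof -
  have "next_free n (occupied n \<alpha> (i - 1)) (\<alpha> i) = Some (spot i)"
    using car_spot[OF i] by (simp add: car_spot_def)
  then have "\<alpha> i \<in> occupied n \<alpha> (i - 1)"
    using next_free_SomeD(4)[of n _ "\<alpha> i" "spot i" "\<alpha> i"] unlucky_spot[OF assms] by simp
  then obtain j where j: "j \<in> {1..i - 1}" "car_spot n \<alpha> j = Some (\<alpha> i)"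
    by (auto simp: occupied_conv_car_spot elem_set)
  then have "j \<in> {1..<i}" "spot j = \<alpha> i" using i by (auto simp: spot_def)
  then show ?thesis using that unlucky_spot[OF assms] by simp
qed

lemma level_mono: "x \<le> y \<Longrightarrow> level x \<le> level y"
  unfolding level_def by (intro card_mono) auto

lemma level_0: "level 0 = 0"
  using spot_in_range by (fastforce simp: level_def)

lemma level_Suc:
  assumes i: "i \<in> {1..n}" and x: "spot i = Suc x"
  shows "level (Suc x) = level x + (if lucky n \<alpha> i then 1 else 0)"
proof -
  have "{l \<in> {1..n}. lucky n \<alpha> l \<and> spot l \<le> Suc x} =
      {l \<in> {1..n}. lucky n \<alpha> l \<and> spot l \<le> x} \<union> (if lucky n \<alpha> i then {i} else {})"
    using i x spot_eq_iff[OF _ i] by (auto simp: le_Suc_eq)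
  then show ?thesis using x by (auto simp: level_def)
qed

lemma spot_pos: "i \<in> {1..n} \<Longrightarrow> spot i = Suc (spot i - 1)"
  using spot_in_range[of i] by simp

lemma level_pref: "i \<in> {1..n} \<Longrightarrow> level (\<alpha> i) = level (spot i)"
  using unlucky_spot[of i] level_Suc[of i "\<alpha> i"] lucky_iff[of i] by fastforce

lemma word_of_upf_eq_level:
  assumes "i \<in> {1..n}"
  shows "word_of_upf n \<alpha> i = level (spot i)"
proof -
  have "{l \<in> {1..n}. lucky n \<alpha> l \<and> \<alpha> l \<le> \<alpha> i} = {l \<in> {1..n}. lucky n \<alpha> l \<and> spot l \<le> \<alpha> i}"
    using lucky_iff by auto
  then show ?thesis using assms level_pref[OF assms] by (simp add: word_of_upf_def level_def)
qed

text \<open>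
  No spot after that of \<open>j\<close> up to that of \<open>i\<close> holds a lucky car, since the level would rise there. Going left
  from \<open>i\<close> through \<open>unlucky_predecessor\<close> therefore leads to \<open>j\<close> through ever earlier cars.
\<close>
lemma same_level_order:
  assumes "j \<in> {1..n}" "i \<in> {1..n}" "spot j < spot i" "level (spot j) = level (spot i)"
  shows "j < i" and "\<not> lucky n \<alpha> i"
proof -
  have unlucky: "\<not> lucky n \<alpha> i" if "i \<in> {1..n}" "spot j < spot i" "level (spot j) = level (spot i)" for i
  proof -
    obtain x where x: "spot i = Suc x" using spot_pos[OF \<open>i \<in> {1..n}\<close>] by blast
    show ?thesis
      using level_Suc[OF that(1) x] level_mono[of "spot j" x] that(2,3) x by auto
  qed
  show "\<not> lucky n \<alpha> i" using assms(2-4) by (rule unlucky)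
  show "j < i" using assms(2-4)
  proof (induction "spot i" arbitrary: i rule: less_induct)
    case less
    obtain i' where i': "i' \<in> {1..<i}" "Suc (spot i') = spot i"
      using unlucky_predecessor[OF less.prems(1) unlucky[OF less.prems]] by metis
    have i'n: "i' \<in> {1..n}" using i' less.prems by auto
    show ?case
    proof (cases "i' = j")
      case False
      then have lt: "spot j < spot i'"
        using i' less.prems spot_eq_iff[OF i'n assms(1)] by auto
      have "level (spot i') = level (spot j)"
        using level_mono[of "spot j" "spot i'"] level_mono[of "spot i'" "spot i"] lt i' less.prems by simp
      then have "j < i'" using less.hyps[of i'] lt i' i'n by simp
      then show ?thesis using i' by simp
    qed (use i' in simp)
  qed
qed

lemma spot_less_imp:
  assumes "j \<in> {1..n}" "i \<in> {1..n}" "spot j < spot i"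
  shows "level (spot j) < level (spot i) \<or> level (spot j) = level (spot i) \<and> j < i"
  using level_mono[of "spot j" "spot i"] same_level_order(1)[OF assms] assms by auto

text \<open>
  By \<open>spot_less_imp\<close> the order of the spots is the lexicographic order by level and time of arrival, which
  is the order that standardization uses.
\<close>
lemma slot_eq_spot:
  assumes i: "i \<in> {1..n}"
  shows "slot n (word_of_upf n \<alpha>) i = spot i"
proof -
  let ?w = "word_of_upf n \<alpha>"
  have "?w j < ?w i \<or> ?w j = ?w i \<and> j \<le> i \<longleftrightarrow> spot j \<le> spot i" if j: "j \<in> {1..n}" for j
    using spot_less_imp[OF i j] spot_less_imp[OF j i] spot_eq_iff[OF i j]
    unfolding word_of_upf_eq_level[OF i] word_of_upf_eq_level[OF j]
    by (cases "spot i" "spot j" rule: linorder_cases) auto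
  then have "slot n ?w i = card {j \<in> {1..n}. spot j \<le> spot i}"
    unfolding slot_def by (intro arg_cong[of _ _ card]) blast
  also have "\<dots> = card (spot ` {j \<in> {1..n}. spot j \<le> spot i})"
  proof (rule card_image[symmetric])
    show "inj_on spot {j \<in> {1..n}. spot j \<le> spot i}"
      by (rule inj_on_subset[OF bij_betw_imp_inj_on[OF spot_bij]]) auto
  qed
  also have "spot ` {j \<in> {1..n}. spot j \<le> spot i} = {1..spot i}"
  proof (intro equalityI subsetI)
    fix s assume s: "s \<in> {1..spot i}"
    then have "s \<in> {1..n}" using spot_in_range[OF i] by auto
    then obtain j where "j \<in> {1..n}" "s = spot j"
      using bij_betw_imp_surj_on[OF spot_bij] by blast
    then show "s \<in> spot ` {j \<in> {1..n}. spot j \<le> spot i}" using s by auto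
  qed (use spot_in_range in auto)
  finally show ?thesis by simp
qed

lemma is_first_iff_lucky:
  assumes i: "i \<in> {1..n}"
  shows "is_first (word_of_upf n \<alpha>) i \<longleftrightarrow> lucky n \<alpha> i"
proof
  assume first: "is_first (word_of_upf n \<alpha>) i"
  show "lucky n \<alpha> i"
  proof (rule ccontr)
    assume unlucky: "\<not> lucky n \<alpha> i"
    then obtain j where j: "j \<in> {1..<i}" "Suc (spot j) = spot i"
      using unlucky_predecessor[OF i] by metis
    have "j \<in> {1..n}" using i j by auto
    then have "word_of_upf n \<alpha> j = word_of_upf n \<alpha> i"
      using level_Suc[OF i j(2)[symmetric]] unlucky j(2) word_of_upf_eq_level[OF i]
        word_of_upf_eq_level[of j] by simp
    then show False using first j(1) by (auto simp: is_first_def)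
  qed
next
  assume lucky: "lucky n \<alpha> i"
  show "is_first (word_of_upf n \<alpha>) i"
    unfolding is_first_def
  proof (intro ballI notI)
    fix j assume j: "j \<in> {1..<i}" and eq: "word_of_upf n \<alpha> j = word_of_upf n \<alpha> i"
    have jn: "j \<in> {1..n}" using i j by auto
    have lev: "level (spot j) = level (spot i)"
      using eq unfolding word_of_upf_eq_level[OF i] word_of_upf_eq_level[OF jn] .
    have "spot j \<noteq> spot i" using spot_eq_iff[OF jn i] j by auto
    then show False
      using same_level_order[OF jn i] same_level_order(1)[OF i jn] lucky lev j
      by (auto simp: neq_iff)
  qed
qed

lemma upf_of_word_of_upf: "upf_of_word n (word_of_upf n \<alpha>) = \<alpha>"
proof (rule PiE_ext[of _ "{1..n}" "\<lambda>_. UNIV"])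
  show "upf_of_word n (word_of_upf n \<alpha>) \<in> {1..n} \<rightarrow>\<^sub>E UNIV" by (simp add: upf_of_word_def)
  show "\<alpha> \<in> {1..n} \<rightarrow>\<^sub>E UNIV" using PF by (auto simp: PF_def)
  fix i assume i: "i \<in> {1..n}"
  then show "upf_of_word n (word_of_upf n \<alpha>) i = \<alpha> i"
    using lucky_iff[OF i] unlucky_spot[OF i] slot_eq_spot[OF i] is_first_iff_lucky[OF i]
    by (cases "lucky n \<alpha> i") (simp_all add: upf_of_word_def)
qed

text \<open>The level starts at 1, because the car in spot 1 is lucky, and grows in steps of at most 1.\<close>
lemma word_of_upf_packed: "word_of_upf n \<alpha> \<in> packed_words n"
proof -
  have "word_of_upf n \<alpha> ` {1..n} = {1..level n}"
  proof (intro equalityI subsetI)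
    fix b assume "b \<in> word_of_upf n \<alpha> ` {1..n}"
    then obtain i where i: "i \<in> {1..n}" "b = level (spot i)" by (auto simp: word_of_upf_eq_level)
    obtain j where j: "j \<in> {1..n}" "spot j = 1"
      using bij_betw_imp_surj_on[OF spot_bij] i(1) by (metis atLeastAtMost_iff imageE le_refl order_trans)
    have "lucky n \<alpha> j" using unlucky_spot[OF j(1)] pref_range[OF j(1)] j(2) by auto
    then have "1 \<le> level 1" using level_Suc[OF j(1), of 0] j(2) by simp
    also have "\<dots> \<le> level (spot i)" using spot_in_range[OF i(1)] by (intro level_mono) auto
    finally show "b \<in> {1..level n}"
      using spot_in_range[OF i(1)] level_mono[of "spot i" n] i(2) by auto
  next
    fix b assume b: "b \<in> {1..level n}"
    \<comment> \<open>The first spot at which the level reaches \<open>b\<close> has level exactly \<open>b\<close>.\<close>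
    define x where "x = (LEAST x. b \<le> level x)"
    have bn: "b \<le> level n" using b by simp
    have x: "b \<le> level x" unfolding x_def using bn by (rule LeastI[of "\<lambda>x. b \<le> level x"])
    have xn: "x \<le> n" unfolding x_def using bn by (rule Least_le[of "\<lambda>x. b \<le> level x"])
    have "x \<noteq> 0" using x b level_0 by (metis atLeastAtMost_iff not_one_le_zero order_trans)
    then obtain y where y: "x = Suc y" by (cases x) auto
    have "level y < b" using not_less_Least[of y "\<lambda>x. b \<le> level x"] y by (simp add: x_def)
    obtain i where i: "i \<in> {1..n}" "spot i = x"
      using bij_betw_imp_surj_on[OF spot_bij] xn y by (metis atLeastAtMost_iff imageE le_add1 plus_1_eq_Suc)
    have "level x = b" using level_Suc[OF i(1)] i(2) y x \<open>level y < b\<close> by (auto split: if_splits)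
    then show "b \<in> word_of_upf n \<alpha> ` {1..n}" using i by (force simp: word_of_upf_eq_level)
  qed
  then show ?thesis by (auto simp: packed_words_def word_of_upf_def)
qed

end

lemma word_encoding_UPF: "word_encoding n (UPF n) (packed_words n) (word_of_upf n) (upf_of_word n)"
proof
  fix \<alpha> assume "\<alpha> \<in> UPF n"
  then interpret unit_interval_pf n \<alpha> by unfold_locales
  show "word_of_upf n \<alpha> \<in> packed_words n" by (rule word_of_upf_packed)
  show "upf_of_word n (word_of_upf n \<alpha>) = \<alpha>" by (rule upf_of_word_of_upf)
next
  fix w \<sigma> assume "w \<in> packed_words n" "\<sigma> permutes {1..n}"
  then show "w \<circ> \<sigma> \<in> packed_words n" unfolding packed_words_eq by (rule words_closed)
qed (simp_all add: upf_of_word_in_UPF word_of_upf_of_word)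

lemma ch_UPF:
  "ch_perm_module n (UPF n) (relabel_action (UPF n) (word_of_upf n) (upf_of_word n)) =
    (\<Sum>ds\<in>compositions n. h_list ds)"
  using word_encoding_UPF[of n] unfolding packed_words_eq
proof (rule ch_relabel_block_words)
  show "sum_list ds = n" if "ds \<in> compositions n" for ds
    using that by (simp add: compositions_def)
qed (simp_all add: block_content_inj_on_compositions)

section \<open>Blocks of unit interval parking functions\<close>

lemma sorted_list_of_set_nth_le_iff:
  fixes S :: "nat set"
  assumes "finite S" "k < card S"
  shows "sorted_list_of_set S ! k \<le> p \<longleftrightarrow> k < card {s \<in> S. s \<le> p}"
proof -
  let ?xs = "sorted_list_of_set S"
  have len: "length ?xs = card S" by simp
  have mono: "?xs ! i \<le> ?xs ! j" if "i \<le> j" "j < length ?xs" for i j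
    using that by (intro sorted_nth_mono) auto
  let ?J = "{j. j < length ?xs \<and> ?xs ! j \<le> p}"
  have "{s \<in> S. s \<le> p} = (!) ?xs ` ?J"
    using set_sorted_list_of_set[OF assms(1)] by (force simp: set_conv_nth simp del: set_sorted_list_of_set)
  moreover have "inj_on ((!) ?xs) ?J"
    by (rule inj_onI) (auto simp: nth_eq_iff_index_eq)
  ultimately have card: "card {s \<in> S. s \<le> p} = card ?J" by (simp add: card_image)
  show ?thesis
  proof (cases "?xs ! k \<le> p")
    case True
    then have "{..k} \<subseteq> ?J" using mono assms(2) len by (auto intro: order_trans)
    then have "card {..k} \<le> card ?J" by (intro card_mono) auto
    then show ?thesis using True card by simp
  next
    case False
    then have "?J \<subseteq> {..<k}" using mono by (force simp: not_less[symmetric])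
    then have "card ?J \<le> card {..<k}" by (intro card_mono) auto
    then show ?thesis using False card by simp
  qed
qed

text \<open>
  Appending \<open>n + 1\<close> gives the last block an end. The position of \<open>p\<close> among the block starts is found by
  counting the starts up to \<open>p\<close>.
\<close>
lemma in_block_iff:
  fixes S :: "nat set"
  assumes "finite S" "k < card S" "p \<le> n"
  shows "(sorted_list_of_set S @ [n + 1]) ! k \<le> p \<and> p < (sorted_list_of_set S @ [n + 1]) ! (k + 1)
    \<longleftrightarrow> card {s \<in> S. s \<le> p} = Suc k"
proof -
  let ?c = "card {s \<in> S. s \<le> p}"
  have lower: "(sorted_list_of_set S @ [n + 1]) ! k \<le> p \<longleftrightarrow> k < ?c"
    using sorted_list_of_set_nth_le_iff[OF assms(1,2)] assms(2) by (simp add: nth_append)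
  have upper: "p < (sorted_list_of_set S @ [n + 1]) ! (k + 1) \<longleftrightarrow> ?c \<le> Suc k"
  proof (cases "Suc k < card S")
    case True
    then show ?thesis
      using sorted_list_of_set_nth_le_iff[OF assms(1) True, of p] by (auto simp: nth_append not_le[symmetric])
  next
    case False
    then have "card S = Suc k" using assms(2) by simp
    moreover have "?c \<le> card S" using assms(1) by (intro card_mono) auto
    ultimately show ?thesis using assms(3) by (simp add: nth_append)
  qed
  show ?thesis unfolding lower upper by auto
qed

context unit_interval_pf
begin

lemma pref_mono_spot:
  assumes "i \<in> {1..n}" "j \<in> {1..n}" "spot i \<le> spot j"
  shows "\<alpha> i \<le> \<alpha> j"
proof (cases "i = j")
  case False
  then have "spot i < spot j" using spot_eq_iff[OF assms(1,2)] assms(3) by simp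
  moreover have "\<alpha> i \<le> spot i" using lucky_iff[OF assms(1)] unlucky_spot[OF assms(1)] by fastforce
  moreover have "spot j \<le> Suc (\<alpha> j)" using lucky_iff[OF assms(2)] unlucky_spot[OF assms(2)] by fastforce
  ultimately show ?thesis by simp
qed simp

text \<open>Listing the entries by the spots of their cars sorts them, as preferences increase weakly with the spots.\<close>
lemma rearrangement_spot:
  assumes "i \<in> {1..n}"
  shows "rearrangement n \<alpha> (spot i) = \<alpha> i"
proof -
  define q where "q = inv_into {1..n} spot"
  have q_bij: "bij_betw q {1..n} {1..n}" unfolding q_def using spot_bij by (rule bij_betw_inv_into)
  have spot_q: "spot (q p) = p" if "p \<in> {1..n}" for p
    using that bij_betw_inv_into_right[OF spot_bij] by (simp add: q_def)
  have q_spot: "q (spot i) = i" if "i \<in> {1..n}" for i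
    using that bij_betw_inv_into_left[OF spot_bij] by (simp add: q_def)
  have set_upt: "set [1..<n + 1] = {1..n}" by auto
  then have mset_upt: "mset [1..<n + 1] = mset_set {1..n}"
    by (metis distinct_upt mset_set_set)
  have "sort (map \<alpha> [1..<n + 1]) = map (\<lambda>p. \<alpha> (q p)) [1..<n + 1]"
  proof (rule properties_for_sort)
    have "mset (map (\<lambda>p. \<alpha> (q p)) [1..<n + 1]) = image_mset \<alpha> (image_mset q (mset_set {1..n}))"
      by (simp only: mset_map mset_upt multiset.map_comp comp_def)
    also have "image_mset q (mset_set {1..n}) = mset_set {1..n}"
      using q_bij by (simp add: bij_betw_def image_mset_mset_set)
    finally show "mset (map (\<lambda>p. \<alpha> (q p)) [1..<n + 1]) = mset (map \<alpha> [1..<n + 1])"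
      by (simp only: mset_map mset_upt)
    show "sorted (map (\<lambda>p. \<alpha> (q p)) [1..<n + 1])"
    proof (rule sorted_map_mono)
      show "mono_on (set [1..<n + 1]) (\<lambda>p. \<alpha> (q p))"
      proof (rule mono_onI)
        fix p p' assume "p \<in> set [1..<n + 1]" "p' \<in> set [1..<n + 1]" "p \<le> p'"
        then show "\<alpha> (q p) \<le> \<alpha> (q p')"
          using bij_betwE[OF q_bij] spot_q unfolding set_upt by (intro pref_mono_spot) auto
      qed
    qed (simp del: upt_Suc)
  qed
  moreover have "[1..<n + 1] ! (spot i - 1) = spot i"
    using nth_upt[of 1 "spot i - 1" "n + 1"] spot_in_range[OF assms] by (simp del: upt_Suc)
  moreover have "spot i - 1 < length [1..<n + 1]" using spot_in_range[OF assms] by auto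
  ultimately show ?thesis
    using q_spot[OF assms] unfolding rearrangement_def by (simp only: nth_map)
qed

lemma ex_car_at_spot:
  assumes "p \<in> {1..n}"
  obtains i where "i \<in> {1..n}" "spot i = p"
  using bij_betw_imp_surj_on[OF spot_bij] assms by (metis imageE)

lemma block_start_positions:
  "{p \<in> {1..n}. rearrangement n \<alpha> p = p} = spot ` {l \<in> {1..n}. lucky n \<alpha> l}"
proof (intro equalityI subsetI)
  fix p assume p: "p \<in> {p \<in> {1..n}. rearrangement n \<alpha> p = p}"
  then obtain i where i: "i \<in> {1..n}" "spot i = p" using ex_car_at_spot by blast
  then have "lucky n \<alpha> i" using p rearrangement_spot[OF i(1)] lucky_iff[OF i(1)] by simp
  then show "p \<in> spot ` {l \<in> {1..n}. lucky n \<alpha> l}" using i by blast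
next
  fix p assume "p \<in> spot ` {l \<in> {1..n}. lucky n \<alpha> l}"
  then obtain i where i: "i \<in> {1..n}" "lucky n \<alpha> i" "p = spot i" by blast
  then show "p \<in> {p \<in> {1..n}. rearrangement n \<alpha> p = p}"
    using spot_in_range[OF i(1)] rearrangement_spot[OF i(1)] lucky_iff[OF i(1)] by simp
qed

lemma card_block_starts_le:
  "card {s \<in> {p \<in> {1..n}. rearrangement n \<alpha> p = p}. s \<le> x} = level x"
proof -
  have "{s \<in> {p \<in> {1..n}. rearrangement n \<alpha> p = p}. s \<le> x} =
      spot ` {l \<in> {1..n}. lucky n \<alpha> l \<and> spot l \<le> x}"
    unfolding block_start_positions by auto
  moreover have "inj_on spot {l \<in> {1..n}. lucky n \<alpha> l \<and> spot l \<le> x}"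
    by (rule inj_on_subset[OF bij_betw_imp_inj_on[OF spot_bij]]) auto
  ultimately show ?thesis by (simp add: level_def card_image)
qed

lemma level_spot_pos:
  assumes "i \<in> {1..n}"
  shows "level (spot i) > 0"
proof -
  obtain k where "word_of_upf n \<alpha> ` {1..n} = {1..k}"
    using word_of_upf_packed by (auto simp: packed_words_def)
  then have "word_of_upf n \<alpha> i \<in> {1..k}" using assms by blast
  then show ?thesis using word_of_upf_eq_level[OF assms] by simp
qed

text \<open>
  An entry of the \<open>k\<close>-th block (counted from 0) has level \<open>k + 1\<close>, both as a spot of the sorted sequence
  and as a value. In particular different blocks have no value in common.
\<close>
lemma same_block_iff:
  assumes i: "i \<in> {1..n}" and j: "j \<in> {1..n}"
  shows "same_block n \<alpha> (\<alpha> i) (\<alpha> j) \<longleftrightarrow> word_of_upf n \<alpha> i = word_of_upf n \<alpha> j"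
proof -
  let ?S = "{p \<in> {1..n}. rearrangement n \<alpha> p = p}"
  let ?bs = "block_starts n \<alpha> @ [n + 1]"
  have fin: "finite ?S" by simp
  have bs: "block_starts n \<alpha> = sorted_list_of_set ?S" by (simp add: block_starts_def)
  have card_S: "card ?S = level n"
    using card_block_starts_le[of n] by (metis (no_types, lifting) Collect_cong atLeastAtMost_iff mem_Collect_eq)
  have in_block: "?bs ! k \<le> p \<and> p < ?bs ! (k + 1) \<longleftrightarrow> level p = Suc k"
    if "k < card ?S" "p \<le> n" for k p
    using in_block_iff[OF fin that] unfolding bs card_block_starts_le .
  have len: "length (block_starts n \<alpha>) = card ?S" by (simp add: bs)
  have level_entry: "level (rearrangement n \<alpha> p) = level p" if "p \<in> {1..n}" for p
  proof -
    obtain l where l: "l \<in> {1..n}" "spot l = p" using ex_car_at_spot[OF \<open>p \<in> {1..n}\<close>] .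
    then show ?thesis using rearrangement_spot[OF l(1)] level_pref[OF l(1)] by simp
  qed
  have block_entry: "level a = Suc k"
    if k: "k < card ?S" and a: "a \<in> set (map (rearrangement n \<alpha>) [?bs ! k ..< ?bs ! (k + 1)])" for k a
  proof -
    obtain p where p: "?bs ! k \<le> p" "p < ?bs ! (k + 1)" "a = rearrangement n \<alpha> p" using a by auto
    have "?bs ! k \<in> ?S"
      using nth_mem[of k "block_starts n \<alpha>"] k len fin by (simp add: nth_append bs)
    moreover have "?bs ! (k + 1) \<le> n + 1"
    proof (cases "k + 1 < card ?S")
      case True
      then have "?bs ! (k + 1) \<in> ?S"
        using nth_mem[of "k + 1" "block_starts n \<alpha>"] len fin by (simp add: nth_append bs)
      then show ?thesis by simp
    next
      case False
      then have "k + 1 = length (block_starts n \<alpha>)" using k len by simp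
      then show ?thesis by (simp only: nth_append_length order_refl)
    qed
    ultimately have "p \<in> {1..n}" using p by auto
    then show ?thesis using in_block[OF k, of p] level_entry[of p] p by auto
  qed
  have set_blocks: "set (blocks n \<alpha>) =
      (\<lambda>k. map (rearrangement n \<alpha>) [?bs ! k ..< ?bs ! (k + 1)]) ` {0..<card ?S}"
    by (simp only: blocks_def Let_def set_map set_upt len)
  have "same_block n \<alpha> (\<alpha> i) (\<alpha> j) \<longleftrightarrow> level (spot i) = level (spot j)"
  proof
    assume "same_block n \<alpha> (\<alpha> i) (\<alpha> j)"
    then obtain \<pi> where \<pi>: "\<pi> \<in> set (blocks n \<alpha>)" "\<alpha> i \<in> set \<pi>" "\<alpha> j \<in> set \<pi>"
      unfolding same_block_def by blast
    from \<pi>(1) obtain k where k: "k \<in> {0..<card ?S}"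
      "\<pi> = map (rearrangement n \<alpha>) [?bs ! k ..< ?bs ! (k + 1)]"
      unfolding set_blocks by (rule imageE)
    have "k < card ?S" using k(1) by simp
    then have "level (\<alpha> i) = level (\<alpha> j)" 
      using block_entry[OF \<open>k < card ?S\<close> \<pi>(2)[unfolded k(2)]]
        block_entry[OF \<open>k < card ?S\<close> \<pi>(3)[unfolded k(2)]] by simp
    then show "level (spot i) = level (spot j)" using level_pref i j by simp
  next
    assume eq: "level (spot i) = level (spot j)"
    define k where "k = level (spot i) - 1"
    have k: "level (spot i) = Suc k" using level_spot_pos[OF i] by (simp add: k_def)
    have "k < card ?S"
      using k level_mono[of "spot i" n] spot_in_range[OF i] unfolding card_S by simp
    have mem: "\<alpha> l \<in> set (map (rearrangement n \<alpha>) [?bs ! k ..< ?bs ! (k + 1)])"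
      if l: "l \<in> {1..n}" "level (spot l) = Suc k" for l
    proof -
      have "spot l \<in> set [?bs ! k ..< ?bs ! (k + 1)]"
        using in_block[OF \<open>k < card ?S\<close>, of "spot l"] l spot_in_range[OF l(1)] by simp
      then show ?thesis using rearrangement_spot[OF l(1)] by (metis image_eqI set_map)
    qed
    show "same_block n \<alpha> (\<alpha> i) (\<alpha> j)"
      unfolding same_block_def
    proof (rule bexI)
      show "\<alpha> i \<in> set (map (rearrangement n \<alpha>) [?bs ! k ..< ?bs ! (k + 1)]) \<and>
          \<alpha> j \<in> set (map (rearrangement n \<alpha>) [?bs ! k ..< ?bs ! (k + 1)])"
        using mem i j k eq by simp
      show "map (rearrangement n \<alpha>) [?bs ! k ..< ?bs ! (k + 1)] \<in> set (blocks n \<alpha>)"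
        unfolding set_blocks using \<open>k < card ?S\<close> by (intro imageI) simp
    qed
  qed
  then show ?thesis by (simp only: word_of_upf_eq_level[OF i] word_of_upf_eq_level[OF j])
qed

end

section \<open>The action of adjacent transpositions\<close>

text \<open>
  An adjacent transposition reverses only the order of \<open>i\<close> and \<open>i + 1\<close>, and these two positions carry different
  letters. So it preserves the order of positions with equal letters, which is all that standardization
  depends on.
\<close>
lemma adjacent_transpose_order:
  assumes "w i \<noteq> w (Suc i)" "w (transpose i (Suc i) x) = w (transpose i (Suc i) y)"
  shows "transpose i (Suc i) x \<le> transpose i (Suc i) y \<longleftrightarrow> x \<le> y"
  using assms by (auto simp: Transposition.transpose_def split: if_splits)

lemma slot_adjacent_transpose:
  assumes i: "i \<in> {1..<n}" and w: "w i \<noteq> w (Suc i)"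
  shows "slot n (w \<circ> transpose i (Suc i)) x = slot n w (transpose i (Suc i) x)"
proof -
  let ?t = "transpose i (Suc i)"
  have range: "?t j \<in> {1..n} \<longleftrightarrow> j \<in> {1..n}" for j
    using i by (auto simp: Transposition.transpose_def)
  have order: "w (?t j) = w (?t x) \<Longrightarrow> ?t j \<le> ?t x \<longleftrightarrow> j \<le> x" for j
    using adjacent_transpose_order[of w i j x] w by simp
  have "bij_betw ?t {j \<in> {1..n}. w (?t j) < w (?t x) \<or> w (?t j) = w (?t x) \<and> j \<le> x}
      {j \<in> {1..n}. w j < w (?t x) \<or> w j = w (?t x) \<and> j \<le> ?t x}"
  proof (rule bij_betwI[where g = ?t])
    show "?t \<in> {j \<in> {1..n}. w (?t j) < w (?t x) \<or> w (?t j) = w (?t x) \<and> j \<le> x} \<rightarrow>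
        {j \<in> {1..n}. w j < w (?t x) \<or> w j = w (?t x) \<and> j \<le> ?t x}"
      using order range by blast
    show "?t \<in> {j \<in> {1..n}. w j < w (?t x) \<or> w j = w (?t x) \<and> j \<le> ?t x} \<rightarrow>
        {j \<in> {1..n}. w (?t j) < w (?t x) \<or> w (?t j) = w (?t x) \<and> j \<le> x}"
    proof
      fix j assume "j \<in> {j \<in> {1..n}. w j < w (?t x) \<or> w j = w (?t x) \<and> j \<le> ?t x}"
      then show "?t j \<in> {j \<in> {1..n}. w (?t j) < w (?t x) \<or> w (?t j) = w (?t x) \<and> j \<le> x}"
        using order[of "?t j"] range[of j] by auto
    qed
  qed simp_all
  then show ?thesis unfolding slot_def o_apply by (rule bij_betw_same_card)
qed

lemma is_first_adjacent_transpose: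
  assumes i: "1 \<le> i" and w: "w i \<noteq> w (Suc i)"
  shows "is_first (w \<circ> transpose i (Suc i)) x \<longleftrightarrow> is_first w (transpose i (Suc i) x)"
proof -
  let ?t = "transpose i (Suc i)"
  have range: "1 \<le> ?t j \<longleftrightarrow> 1 \<le> j" for j
    using i by (auto simp: Transposition.transpose_def)
  have order: "w (?t j) = w (?t x) \<Longrightarrow> ?t j < ?t x \<longleftrightarrow> j < x" for j
    using adjacent_transpose_order[of w i x j] w by (simp add: not_le[symmetric])
  have "(\<exists>j. 1 \<le> j \<and> j < x \<and> w (?t j) = w (?t x)) \<longleftrightarrow> (\<exists>j. 1 \<le> j \<and> j < ?t x \<and> w j = w (?t x))"
  proof
    assume "\<exists>j. 1 \<le> j \<and> j < x \<and> w (?t j) = w (?t x)"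
    then obtain j where "1 \<le> j" "j < x" "w (?t j) = w (?t x)" by blast
    then show "\<exists>j. 1 \<le> j \<and> j < ?t x \<and> w j = w (?t x)"
      using order[of j] range[of j] by (intro exI[of _ "?t j"]) simp
  next
    assume "\<exists>j. 1 \<le> j \<and> j < ?t x \<and> w j = w (?t x)"
    then obtain j where "1 \<le> j" "j < ?t x" "w j = w (?t x)" by blast
    then show "\<exists>j. 1 \<le> j \<and> j < x \<and> w (?t j) = w (?t x)"
      using order[of "?t j"] range[of j] by (intro exI[of _ "?t j"]) simp
  qed
  then show ?thesis by (auto simp: is_first_def)
qed

lemma upf_of_word_adjacent_transpose:
  assumes i: "i \<in> {1..<n}" and w: "w i \<noteq> w (Suc i)"
  shows "upf_of_word n (w \<circ> transpose i (Suc i)) = upf_of_word n w \<circ> transpose i (Suc i)"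
proof
  fix x
  have "transpose i (Suc i) x \<in> {1..n} \<longleftrightarrow> x \<in> {1..n}"
    using i by (auto simp: Transposition.transpose_def)
  then show "upf_of_word n (w \<circ> transpose i (Suc i)) x = (upf_of_word n w \<circ> transpose i (Suc i)) x"
    using slot_adjacent_transpose[of i n w x] is_first_adjacent_transpose[of i w x] i w
    by (simp add: upf_of_word_def restrict_def)
qed

text \<open>
  Exchanging equal letters of \<open>w\<close> changes nothing; this is the case of two entries in the same block.
\<close>
lemma is_UPF_action_relabel:
  "is_UPF_action n (relabel_action (UPF n) (word_of_upf n) (upf_of_word n))"
  unfolding is_UPF_action_def
proof (intro conjI ballI)
  show "group_action (sym_group n) (UPF n) (relabel_action (UPF n) (word_of_upf n) (upf_of_word n))"
    using word_encoding_UPF by (rule word_encoding.group_action_relabel)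
  fix i \<alpha> assume i: "i \<in> {1..<n}" and \<alpha>: "\<alpha> \<in> UPF n"
  interpret unit_interval_pf n \<alpha> by unfold_locales (fact \<alpha>)
  let ?w = "word_of_upf n \<alpha>" and ?t = "transpose i (Suc i)"
  have act: "relabel_action (UPF n) (word_of_upf n) (upf_of_word n) ?t \<alpha> = upf_of_word n (?w \<circ> ?t)"
    using \<alpha> by (simp add: relabel_action_def)
  have same: "same_block n \<alpha> (\<alpha> i) (\<alpha> (Suc i)) \<longleftrightarrow> ?w i = ?w (Suc i)"
    using i by (intro same_block_iff) auto
  have "upf_of_word n (?w \<circ> ?t) = (if ?w i = ?w (Suc i) then \<alpha> else \<alpha> \<circ> ?t)"
  proof (cases "?w i = ?w (Suc i)")
    case True
    then have "?w \<circ> ?t = ?w" by (auto simp: fun_eq_iff Transposition.transpose_def)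
    then show ?thesis using True by (simp add: upf_of_word_of_upf)
  next
    case False
    then show ?thesis using upf_of_word_adjacent_transpose[OF i False] by (simp add: upf_of_word_of_upf)
  qed
  then show "relabel_action (UPF n) (word_of_upf n) (upf_of_word n) (transpose i (i + 1)) \<alpha> =
      (if same_block n \<alpha> (\<alpha> i) (\<alpha> (i + 1)) then \<alpha> else \<alpha> \<circ> transpose i (i + 1))"
    using act same by simp
qed

section \<open>The generating functions\<close>

theorem theorem1p2:
  shows
    "(\<forall>n. group_action (sym_group n) (PF n) (PF_action n)) \<and>
     (fps_X * Abs_fps (\<lambda>n. ch_perm_module n (PF n) (PF_action n))) oo
       (fps_X * (E_series oo (- fps_X))) = fps_X \<and>
     (\<exists>\<phi>. (\<forall>n. is_UPF_action n (\<phi> n)) \<and>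
       Abs_fps (\<lambda>n. ch_perm_module n (UPF n) (\<phi> n)) * (2 - H_series) = 1)"
proof (intro conjI allI exI)
  show "group_action (sym_group n) (PF n) (PF_action n)" for n
    unfolding PF_action_eq using word_encoding_PF by (rule word_encoding.group_action_relabel)
  show "(fps_X * Abs_fps (\<lambda>n. ch_perm_module n (PF n) (PF_action n))) oo
      (fps_X * (E_series oo (- fps_X))) = fps_X"
    unfolding ch_PF by (rule parking_inverse_series[unfolded parking_series_def])
  show "is_UPF_action n (relabel_action (UPF n) (word_of_upf n) (upf_of_word n))" for n
    by (rule is_UPF_action_relabel)
  show "Abs_fps (\<lambda>n. ch_perm_module n (UPF n)
      (relabel_action (UPF n) (word_of_upf n) (upf_of_word n))) * (2 - H_series) = 1"
    unfolding ch_UPF by (rule composition_series_eq[unfolded composition_series_def])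
qed

end
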